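(* Let $\mathcal K$ be a simplicial complex on the vertex set $[4]=\{1,2,3,4\}$, let $RC_{\mathcal K}$ be the corresponding right-angled Coxeter group, and let $L^4(RC_{\mathcal K})=\gamma_4(RC_{\mathcal K})/\gamma_5(RC_{\mathcal K})$. Write $[a\,b\,c\,d]:=[\mu_a,\mu_b,\mu_c,\mu_d]$ for the left-nested Lie commutator. Below, $i,j,k,l$ denote pairwise distinct elements of $[4]$ (so $\{i,j,k,l\}=[4]$ whenever all four letters are in use), and the edges of $\mathcal K$ are its two-element simplices. (a) If $\mathcal K$ contains all six edges, then $L^4(RC_{\mathcal K})$ is trivial (there are no generators). (b) If $\mathcal K$ contains exactly five edges and the missing edge is $\{i,j\}$, $i<j$, then $L^4(RC_{\mathcal K})\cong\mathbb Z_2$ is minimally generated by $[j\,i\,i\,i]$. (c) If $\mathcal K$ contains exactly four edges and the missing edges are: - $\{i,k\},\{j,l\}$ with $k<i$, $l<j$, then $L^4(RC_{\mathcal K})\cong\mathbb Z_2\oplus\mathbb Z_2$ is minimally generated by $[i\,k\,k\,k],[j\,l\,l\,l]$; - $\{i,k\},\{k,l\}$ with $i<k<l$, then $L^4(RC_{\mathcal K})\cong\mathbb Z_2^4$ is minimally generated by $[k\,i\,i\,i],[l\,k\,k\,k],[k\,l\,k\,i],[k\,l\,i\,k]$. (d) If $\mathcal K$ contains exactly three edges and they are: - $\{l,j\},\{l,k\},\{l,i\}$ with $i<j<k$, then $L^4(RC_{\mathcal K})\cong\mathbb Z_2^8$ is minimally generated by $[j\,i\,i\,i],[k\,i\,i\,i],[k\,j\,j\,i],[k\,i\,j\,i],[k\,i\,i\,j],[k\,j\,j\,j],[k\,j\,i\,j],[k\,i\,j\,k]$;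 - $\{j,k\},\{j,l\},\{k,l\}$ with $j<k<l$, then $L^4(RC_{\mathcal K})\cong\mathbb Z_2^{10}$ is minimally generated by $[i\,k\,i\,j],[i\,k\,j\,i],[i\,j\,j\,j],[i\,l\,i\,j],[i\,l\,j\,i],[i\,k\,k\,k],[l\,i\,i\,i],[i\,l\,i\,k],[i\,l\,k\,i],[i\,l\,j\,k]$; - $\{i,j\},\{j,k\},\{k,l\}$, then $L^4(RC_{\mathcal K})\cong\mathbb Z_2^8$ is minimally generated by $[k\,i\,k\,k],[i\,l\,i\,k],[i\,l\,k\,i],[i\,l\,i\,i],[l\,j\,l\,l],[l\,j\,l\,i],[l\,j\,i\,l],[l\,j\,i\,k]$. (e) If $\mathcal K$ contains exactly two edges and they are: - $\{i,j\}$ and $\{i,l\}$, then $L^4(RC_{\mathcal K})\cong\mathbb Z_2^{15}$ is minimally generated by $[l\,k\,k\,j],[l\,j\,k\,j],[l\,j\,j\,k],[l\,k\,j\,k],[l\,j\,k\,l],[i\,k\,k\,j],[i\,k\,j\,k],[k\,j\,j\,j],[l\,j\,j\,j],[l\,k\,l\,l],[k\,i\,k\,k],[k\,i\,k\,l],[k\,i\,l\,k],[k\,i\,l\,j],[k\,i\,j\,l]$; - $\{i,j\}$ and $\{k,l\}$, then $L^4(RC_{\mathcal K})\cong\mathbb Z_2^{15}$ is minimally generated by $[k\,j\,k\,i],[k\,j\,i\,k],[k\,i\,k\,k],[i\,l\,i\,k],[i\,l\,k\,i],[i\,l\,i\,i],[l\,j\,l\,i],[l\,j\,i\,l],[k\,j\,k\,k],[j\,l\,j\,j],[j\,l\,j\,k],[j\,l\,k\,j],[i\,l\,k\,j],[j\,l\,i\,k],[j\,l\,k\,i]$.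 (f) If $\mathcal K$ contains exactly one edge $\{i,j\}$, then $L^4(RC_{\mathcal K})\cong\mathbb Z_2^{23}$ is minimally generated by $[i\,l\,l\,k],[i\,k\,l\,k],[i\,k\,k\,l],[i\,l\,k\,l],[i\,k\,l\,i],[l\,k\,k\,k],[j\,l\,l\,k],[j\,k\,l\,k],[j\,k\,k\,l],[j\,l\,k\,l],[j\,k\,l\,j],[i\,k\,i\,i],[k\,j\,k\,k],[k\,j\,k\,i],[k\,j\,i\,k],[i\,l\,i\,i],[l\,j\,l\,l],[l\,j\,l\,i],[l\,j\,i\,l],[l\,j\,i\,k],[k\,j\,i\,l],[k\,j\,l\,i],[l\,j\,k\,i]$.
   Context: Simplicial complexes on $[m]=\{1,\dots,m\}$ are abstract simplicial complexes containing $\varnothing$ and all singletons $\{i\}$. The right-angled Coxeter group of $\mathcal K$ is $RC_{\mathcal K}=\langle g_1,\dots,g_m \mid g_i^2=1 \text{ for all } i,\ g_ig_j=g_jg_i \text{ for } \{i,j\}\in\mathcal K\rangle$. For a group $G$, $(a,b)=a^{-1}b^{-1}ab$, $\gamma_1(G)=G$, $\gamma_{k+1}(G)=(\gamma_k(G),G)$ (subgroup generated by commutators), and $L^k(G)=\gamma_k(G)/\gamma_{k+1}(G)$. The associated Lie algebra is $L(G)=\bigoplus_{k\ge1}L^k(G)$, a graded Lie ring with bracket $[\overline{a},\overline{b}]=\overline{(a,b)}$ for $a\in\gamma_k(G)$, $b\in\gamma_l(G)$, where $\overline{x}$ is the class of $x\in\gamma_n(G)$ in $L^n(G)$ and $\overline{(a,b)}\in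 L^{k+l}(G)$. For $G=RC_{\mathcal K}$, $\mu_i\in L^1(RC_{\mathcal K})$ denotes the class of $g_i$. Nested Lie commutators are left-nested: $[\mu_a,\mu_b,\mu_c,\mu_d]=[[[\mu_a,\mu_b],\mu_c],\mu_d]$. The square of every element of $\gamma_k(RC_{\mathcal K})$ lies in $\gamma_{k+1}(RC_{\mathcal K})$, so each $L^k(RC_{\mathcal K})$ is a $\mathbb Z_2$-vector space; "minimally generated" by a list means that the list is a minimal generating set, i.e. a basis over $\mathbb Z_2=\mathbb Z/2\mathbb Z$. *)

theory Defs
  imports "HOL-Algebra.Elementary_Groups" "HOL-Algebra.Product_Groups"
begin

section \<open>Groups given by generators and relations\<close>

text \<open>A word is a list of signed letters: \<open>(x, True)\<close> stands for \<open>x\<close> and \<open>(x, False)\<close> for the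
  formal inverse of \<open>x\<close>.  A relation \<open>(r, s)\<close> imposes the equation \<open>r = s\<close>.\<close>

type_synonym 'a word = "('a \<times> bool) list"

definition words :: "'a set \<Rightarrow> 'a word set" where
  "words S = lists (S \<times> UNIV)"

inductive pres_eq :: "'a set \<Rightarrow> ('a word \<times> 'a word) set \<Rightarrow> 'a word \<Rightarrow> 'a word \<Rightarrow> bool"
  for S :: "'a set" and R :: "('a word \<times> 'a word) set" where
  refl: "w \<in> words S \<Longrightarrow> pres_eq S R w w"
| sym: "pres_eq S R v w \<Longrightarrow> pres_eq S R w v"
| trans: "pres_eq S R u v \<Longrightarrow> pres_eq S R v w \<Longrightarrow> pres_eq S R u w"
| cancel: "u \<in> words S \<Longrightarrow> v \<in> words S \<Longrightarrow> x \<in> S \<Longrightarrow>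
    pres_eq S R (u @ [(x, b), (x, \<not> b)] @ v) (u @ v)"
| rel: "(r, s) \<in> R \<Longrightarrow> r \<in> words S \<Longrightarrow> s \<in> words S \<Longrightarrow> u \<in> words S \<Longrightarrow> v \<in> words S \<Longrightarrow>
    pres_eq S R (u @ r @ v) (u @ s @ v)"

definition pres_rel :: "'a set \<Rightarrow> ('a word \<times> 'a word) set \<Rightarrow> 'a word rel" where
  "pres_rel S R = {(u, v). pres_eq S R u v}"

definition presented_group :: "'a set \<Rightarrow> ('a word \<times> 'a word) set \<Rightarrow> 'a word set monoid" where
  "presented_group S R =
     \<lparr> carrier = words S // pres_rel S R,
       mult = (\<lambda>X Y. \<Union>x\<in>X. \<Union>y\<in>Y. pres_rel S R `` {x @ y}),
       one = pres_rel S R `` {[]} \<rparr>"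

definition pres_gen :: "'a set \<Rightarrow> ('a word \<times> 'a word) set \<Rightarrow> 'a \<Rightarrow> 'a word set" where
  "pres_gen S R x = pres_rel S R `` {[(x, True)]}"

lemma words_Nil [simp]: "[] \<in> words S"
  and words_append [simp]: "u @ v \<in> words S \<longleftrightarrow> u \<in> words S \<and> v \<in> words S"
  and words_Cons [simp]: "p # v \<in> words S \<longleftrightarrow> fst p \<in> S \<and> v \<in> words S"
  by (auto simp: words_def mem_Times_iff)

lemma pres_eq_words: "pres_eq S R u v \<Longrightarrow> u \<in> words S \<and> v \<in> words S"
  by (induction rule: pres_eq.induct) auto

lemma pres_eq_context:
  assumes "pres_eq S R u v" "a \<in> words S" "b \<in> words S"
  shows "pres_eq S R (a @ u @ b) (a @ v @ b)"
  using assms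
proof (induction rule: pres_eq.induct)
  case (cancel u v x c)
  then show ?case using pres_eq.cancel[of "a @ u" S "v @ b" x R c] by simp
next
  case (rel r s u v)
  then show ?case using pres_eq.rel[of r s R S "a @ u" "v @ b"] by simp
next
  case (refl w)
  then show ?case by (simp add: pres_eq.refl)
next
  case (sym v w)
  then show ?case by (blast intro: pres_eq.sym)
next
  case (trans u v w)
  then show ?case by (blast intro: pres_eq.trans)
qed

lemma pres_eq_append:
  assumes "pres_eq S R u u'" "pres_eq S R v v'"
  shows "pres_eq S R (u @ v) (u' @ v')"
proof -
  have "pres_eq S R (u @ v) (u' @ v)"
    using pres_eq_context[OF assms(1), of "[]" v] pres_eq_words[OF assms(2)] by simp
  moreover have "pres_eq S R (u' @ v) (u' @ v')"
    using pres_eq_context[OF assms(2), of u' "[]"] pres_eq_words[OF assms(1)] by simp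
  ultimately show ?thesis by (rule pres_eq.trans)
qed

lemma equiv_pres_rel: "equiv (words S) (pres_rel S R)"
proof (rule equivI)
  show "pres_rel S R \<subseteq> words S \<times> words S"
    using pres_eq_words by (fastforce simp: pres_rel_def)
  show "refl_on (words S) (pres_rel S R)"
    by (simp add: pres_rel_def refl_on_def pres_eq.refl)
  show "sym (pres_rel S R)"
    unfolding pres_rel_def sym_def using pres_eq.sym by fast
  show "trans (pres_rel S R)"
    unfolding pres_rel_def trans_def using pres_eq.trans by fast
qed

lemma pres_class_eq_iff:
  assumes "u \<in> words S" "v \<in> words S"
  shows "pres_rel S R `` {u} = pres_rel S R `` {v} \<longleftrightarrow> pres_eq S R u v"
  using eq_equiv_class_iff[OF equiv_pres_rel assms, of R] by (simp add: pres_rel_def)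

lemma presented_mult:
  assumes "u \<in> words S" "v \<in> words S"
  shows "pres_rel S R `` {u} \<otimes>\<^bsub>presented_group S R\<^esub> pres_rel S R `` {v} = pres_rel S R `` {u @ v}"
proof -
  have *: "pres_rel S R `` {x @ y} = pres_rel S R `` {u @ v}"
    if "x \<in> pres_rel S R `` {u}" "y \<in> pres_rel S R `` {v}" for x y
  proof -
    have "pres_eq S R (u @ v) (x @ y)"
      using that by (simp add: pres_rel_def pres_eq_append)
    then show ?thesis
      using pres_class_eq_iff pres_eq_words by blast
  qed
  have "u \<in> pres_rel S R `` {u}" "v \<in> pres_rel S R `` {v}"
    using assms by (simp_all add: pres_rel_def pres_eq.refl)
  then have "(\<Union>x\<in>pres_rel S R `` {u}. \<Union>y\<in>pres_rel S R `` {v}. pres_rel S R `` {x @ y})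
      = pres_rel S R `` {u @ v}"
    using * by blast
  then show ?thesis
    by (simp only: presented_group_def monoid.simps)
qed

lemma presented_carrierE:
  assumes "X \<in> carrier (presented_group S R)"
  obtains u where "u \<in> words S" "X = pres_rel S R `` {u}"
  using assms by (auto simp: presented_group_def elim: quotientE)

lemma presented_carrierI: "u \<in> words S \<Longrightarrow> pres_rel S R `` {u} \<in> carrier (presented_group S R)"
  by (auto simp: presented_group_def intro: quotientI)

lemma presented_one: "\<one>\<^bsub>presented_group S R\<^esub> = pres_rel S R `` {[]}"
  by (simp add: presented_group_def)

lemma pres_eq_inverse:
  "u \<in> words S \<Longrightarrow> pres_eq S R (rev (map (\<lambda>(x, b). (x, \<not> b)) u) @ u) []"
proof (induction u)
  case Nil
  then show ?case by (simp add: pres_eq.refl)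
next
  case (Cons p u)
  obtain x b where p: "p = (x, b)" by fastforce
  define i where "i = rev (map (\<lambda>(x, b :: bool). (x, \<not> b)) u)"
  have IH: "pres_eq S R (i @ u) []" using Cons by (simp add: i_def)
  then have "i \<in> words S" "u \<in> words S" "x \<in> S"
    using Cons.prems p by (auto dest: pres_eq_words)
  then have "pres_eq S R (i @ [(x, \<not> b), (x, b)] @ u) (i @ u)"
    using pres_eq.cancel[of i S u x R "\<not> b"] by simp
  from pres_eq.trans[OF this IH] show ?case by (simp add: p i_def)
qed

lemma inverse_words: "u \<in> words S \<Longrightarrow> rev (map (\<lambda>(x, b :: bool). (x, \<not> b)) u) \<in> words S"
  by (auto simp: words_def)

lemma presented_group_is_group: "group (presented_group S R)"
proof (rule groupI)
  fix X Y assume "X \<in> carrier (presented_group S R)" "Y \<in> carrier (presented_group S R)"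
  then obtain u v where "u \<in> words S" "X = pres_rel S R `` {u}"
    "v \<in> words S" "Y = pres_rel S R `` {v}"
    by (elim presented_carrierE)
  then show "X \<otimes>\<^bsub>presented_group S R\<^esub> Y \<in> carrier (presented_group S R)"
    by (simp only: presented_mult presented_carrierI words_append)
next
  fix X Y Z assume "X \<in> carrier (presented_group S R)" "Y \<in> carrier (presented_group S R)"
    "Z \<in> carrier (presented_group S R)"
  then obtain u v w where "u \<in> words S" "X = pres_rel S R `` {u}"
    "v \<in> words S" "Y = pres_rel S R `` {v}" "w \<in> words S" "Z = pres_rel S R `` {w}"
    by (elim presented_carrierE)
  then show "X \<otimes>\<^bsub>presented_group S R\<^esub> Y \<otimes>\<^bsub>presented_group S R\<^esub> Z =
      X \<otimes>\<^bsub>presented_group S R\<^esub> (Y \<otimes>\<^bsub>presented_group S R\<^esub> Z)"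
    by (simp only: presented_mult words_append append_assoc)
next
  fix X assume X: "X \<in> carrier (presented_group S R)"
  then obtain u where u: "u \<in> words S" "X = pres_rel S R `` {u}" by (rule presented_carrierE)
  show "\<one>\<^bsub>presented_group S R\<^esub> \<otimes>\<^bsub>presented_group S R\<^esub> X = X"
    by (simp only: u presented_one presented_mult words_Nil append_Nil)
  define i where "i = rev (map (\<lambda>(x, b :: bool). (x, \<not> b)) u)"
  have i: "i \<in> words S" "pres_eq S R (i @ u) []"
    using pres_eq_inverse[OF u(1)] inverse_words[OF u(1)] by (simp_all add: i_def)
  have "pres_rel S R `` {i @ u} = pres_rel S R `` {[]}"
    using i u(1) pres_class_eq_iff[of "i @ u" S "[]" R] by simp
  then have "pres_rel S R `` {i} \<otimes>\<^bsub>presented_group S R\<^esub> X = \<one>\<^bsub>presented_group S R\<^esub>"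
    by (simp only: u presented_one presented_mult i(1))
  then show "\<exists>Y\<in>carrier (presented_group S R). Y \<otimes>\<^bsub>presented_group S R\<^esub> X = \<one>\<^bsub>presented_group S R\<^esub>"
    using presented_carrierI[OF i(1)] by blast
qed (simp only: presented_one presented_carrierI words_Nil)


section \<open>Simplicial complexes and right-angled Coxeter groups\<close>

definition simplicial_complex :: "nat \<Rightarrow> nat set set \<Rightarrow> bool" where
  "simplicial_complex m K \<longleftrightarrow>
     (\<forall>A\<in>K. A \<subseteq> {1..m}) \<and> (\<forall>A\<in>K. \<forall>B. B \<subseteq> A \<longrightarrow> B \<in> K) \<and> {} \<in> K \<and> (\<forall>i\<in>{1..m}. {i} \<in> K)"

definition edges :: "nat set set \<Rightarrow> nat set set" where
  "edges K = {e \<in> K. card e = 2}"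

definition missing_edges :: "nat \<Rightarrow> nat set set \<Rightarrow> nat set set" where
  "missing_edges m K = {e. e \<subseteq> {1..m} \<and> card e = 2 \<and> e \<notin> K}"

definition RC_relations :: "nat \<Rightarrow> nat set set \<Rightarrow> (nat word \<times> nat word) set" where
  "RC_relations m K =
     {([(i, True), (i, True)], []) | i. i \<in> {1..m}} \<union>
     {([(i, True), (j, True)], [(j, True), (i, True)]) | i j. i \<in> {1..m} \<and> j \<in> {1..m} \<and> {i, j} \<in> K}"

definition RC :: "nat \<Rightarrow> nat set set \<Rightarrow> nat word set monoid" where
  "RC m K = presented_group {1..m} (RC_relations m K)"

definition RC_gen :: "nat \<Rightarrow> nat set set \<Rightarrow> nat \<Rightarrow> nat word set" where
  "RC_gen m K i = pres_gen {1..m} (RC_relations m K) i"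

lemma RC_group: "group (RC m K)"
  by (simp add: RC_def presented_group_is_group)


section \<open>Lower central series and the associated graded Lie ring\<close>

definition commutator :: "('a, 'b) monoid_scheme \<Rightarrow> 'a \<Rightarrow> 'a \<Rightarrow> 'a" where
  "commutator G a b = inv\<^bsub>G\<^esub> a \<otimes>\<^bsub>G\<^esub> inv\<^bsub>G\<^esub> b \<otimes>\<^bsub>G\<^esub> a \<otimes>\<^bsub>G\<^esub> b"

text \<open>The series is indexed from \<open>1\<close>; the value at \<open>0\<close> is a dummy.\<close>

fun lower_central :: "('a, 'b) monoid_scheme \<Rightarrow> nat \<Rightarrow> 'a set" where
  "lower_central G 0 = carrier G"
| "lower_central G (Suc 0) = carrier G"
| "lower_central G (Suc (Suc k)) =
     generate G {commutator G a b | a b. a \<in> lower_central G (Suc k) \<and> b \<in> carrier G}"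

definition Lie_component :: "('a, 'b) monoid_scheme \<Rightarrow> nat \<Rightarrow> 'a set monoid" where
  "Lie_component G k = (G\<lparr>carrier := lower_central G k\<rparr>) Mod lower_central G (Suc k)"

definition Lie_class :: "('a, 'b) monoid_scheme \<Rightarrow> nat \<Rightarrow> 'a \<Rightarrow> 'a set" where
  "Lie_class G k a = lower_central G (Suc k) #>\<^bsub>G\<^esub> a"

text \<open>The bracket of the degree \<open>k\<close> component with the degree \<open>l\<close> component.  The class of the
  commutator does not depend on the representatives \<open>a\<close>, \<open>b\<close>, so the union is that single class.\<close>

definition Lie_bracket ::
    "('a, 'b) monoid_scheme \<Rightarrow> nat \<Rightarrow> nat \<Rightarrow> 'a set \<Rightarrow> 'a set \<Rightarrow> 'a set" where
  "Lie_bracket G k l X Y = (\<Union>a\<in>X. \<Union>b\<in>Y. Lie_class G (k + l) (commutator G a b))"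

definition \<mu> :: "nat \<Rightarrow> nat set set \<Rightarrow> nat \<Rightarrow> nat word set set" where
  "\<mu> m K i = Lie_class (RC m K) 1 (RC_gen m K i)"

definition \<mu>_bracket4 :: "nat \<Rightarrow> nat set set \<Rightarrow> nat \<Rightarrow> nat \<Rightarrow> nat \<Rightarrow> nat \<Rightarrow> nat word set set" where
  "\<mu>_bracket4 m K a b c d =
     Lie_bracket (RC m K) 3 1
       (Lie_bracket (RC m K) 2 1 (Lie_bracket (RC m K) 1 1 (\<mu> m K a) (\<mu> m K b)) (\<mu> m K c))
       (\<mu> m K d)"


section \<open>Minimal generation and elementary abelian 2-groups\<close>

text \<open>The list must have no repeated entries: its length is the number of generators.\<close>

definition minimally_generated_by :: "('a, 'b) monoid_scheme \<Rightarrow> 'a list \<Rightarrow> bool" where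
  "minimally_generated_by G xs \<longleftrightarrow>
     distinct xs \<and> set xs \<subseteq> carrier G \<and> generate G (set xs) = carrier G \<and>
     (\<forall>T. T \<subset> set xs \<longrightarrow> generate G T \<noteq> carrier G)"

abbreviation Z2 :: "int monoid" where
  "Z2 \<equiv> integer_mod_group 2"

definition Z2_power :: "nat \<Rightarrow> (nat \<Rightarrow> int) monoid" where
  "Z2_power n = product_group {..<n} (\<lambda>_. Z2)"

end

theory Submission
  imports Defs "HOL-Algebra.FiniteProduct" "HOL.Modules"
begin

text \<open>For the upper bound, \<open>L\<^sup>4\<close> is spanned by the brackets of four generators, it has exponent 2, and Jacobi
  identities together with \<open>[u, x, x] = [u, x]\<^sup>2\<close> (the class of the square of a commutator with an
  involution \<open>x\<close>) reduce every bracket to the listed ones.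

  For the lower bound, the group is mapped to the units of an endomorphism ring \<open>R\<close> by
  \<open>g\<^sub>a \<mapsto> 1 + 2(\<rho>\<^sub>a - 1)\<close> with idempotents \<open>\<rho>\<^sub>a\<close> that commute along edges.  Such a representation
  sends \<open>\<gamma>\<^sub>n\<close> into \<open>1 + 2\<^sup>n R\<close>, and a fourfold commutator of generators goes to
  \<open>1 + 16 [\<rho>\<^sub>a, \<rho>\<^sub>b, \<rho>\<^sub>c, \<rho>\<^sub>d]\<close> modulo 32.  Hence additive functionals on \<open>R\<close> modulo 2 descend to \<open>L\<^sup>4\<close>,
  and for each graph a system of functionals dual to the listed brackets is exhibited.\<close>

section \<open>Commutator calculus\<close>

text \<open>The usual detector of lower central classes, a Magnus expansion \<open>1 + x_a\<close>
  modulo 2 with \<open>x_a^2 = 0\<close>, is blind here. The bracket \<open>[j, i, i, i]\<close> is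
  the class of the eighth power of \<open>g_j g_i\<close>, and in characteristic 2 the eighth power
  of 1 + X is 1 + X^8, so it looks like an element of degree eight. Each further commutator with an
  involution that inverts u squares u up to inversion, so weight shows up as divisibility by 2
  rather than as word length. Hence the integral coefficients, with the congruence filtration by
  powers of 2 in place of the degree filtration.

  The same doubling separates the graded ring from a partially commutative Lie ring reduced modulo
  2: it forces identities such as \<open>[a, b, a, d] = [a, b, d, d]\<close>, without which the
  upper bound would be too large.\<close>

context group
begin

text \<open>With \<open>m_assoc\<close> and \<open>inv_mult_group\<close>, this rule and the next
  reduce words in a free group, so that the simplifier alone proves the commutator identities
  below.\<close>

lemma cancel_l_inv [simp]: "x \<in> carrier G \<Longrightarrow> y \<in> carrier G \<Longrightarrow> inv x \<otimes> (x \<otimes> y) = y"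
  by (simp flip: m_assoc)

lemma cancel_r_inv [simp]: "x \<in> carrier G \<Longrightarrow> y \<in> carrier G \<Longrightarrow> x \<otimes> (inv x \<otimes> y) = y"
  by (simp flip: m_assoc)

lemma commutator_closed [simp]:
  "x \<in> carrier G \<Longrightarrow> y \<in> carrier G \<Longrightarrow> commutator G x y \<in> carrier G"
  by (simp add: commutator_def)

lemma inv_commutator:
  "x \<in> carrier G \<Longrightarrow> y \<in> carrier G \<Longrightarrow> inv (commutator G x y) = commutator G y x"
  by (simp add: commutator_def m_assoc inv_mult_group)

lemma commutator_mult_left:
  "\<lbrakk>x \<in> carrier G; x' \<in> carrier G; y \<in> carrier G\<rbrakk> \<Longrightarrow>
     commutator G (x \<otimes> x') y = commutator G x y \<otimes> commutator G (commutator G x y) x' \<otimes> commutator G x' y"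
  by (simp add: commutator_def m_assoc inv_mult_group)

lemma commutator_mult_right:
  "\<lbrakk>x \<in> carrier G; y \<in> carrier G; z \<in> carrier G\<rbrakk> \<Longrightarrow>
     commutator G x (y \<otimes> z) = commutator G x z \<otimes> commutator G x y \<otimes> commutator G (commutator G x y) z"
  by (simp add: commutator_def m_assoc inv_mult_group)

lemma mult_commutator:
  "x \<in> carrier G \<Longrightarrow> y \<in> carrier G \<Longrightarrow> x \<otimes> y = y \<otimes> x \<otimes> commutator G x y"
  by (simp add: commutator_def m_assoc inv_mult_group)

text \<open>Serves twice: exactly, to bound the weight of a commutator, and modulo the next term of
  the series, as the Jacobi identity.\<close>

lemma Hall_Witt:
  "\<lbrakk>x \<in> carrier G; y \<in> carrier G; z \<in> carrier G\<rbrakk> \<Longrightarrow>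
     (inv y \<otimes> commutator G (commutator G x (inv y)) z \<otimes> y) \<otimes>
     (inv z \<otimes> commutator G (commutator G y (inv z)) x \<otimes> z) \<otimes>
     (inv x \<otimes> commutator G (commutator G z (inv x)) y \<otimes> x) = \<one>"
  by (simp add: commutator_def m_assoc inv_mult_group)

lemma conj_commutator:
  "\<lbrakk>x \<in> carrier G; y \<in> carrier G; g \<in> carrier G\<rbrakk> \<Longrightarrow>
     g \<otimes> commutator G x y \<otimes> inv g = commutator G (g \<otimes> x \<otimes> inv g) (g \<otimes> y \<otimes> inv g)"
  by (simp add: commutator_def m_assoc inv_mult_group)

text \<open>For an involution y, (x, y) is the product of the two involutions x^-1 y x and y, so
  conjugation by y inverts it; the same holds for its inverse (y, x).\<close>

lemma conj_involution_commutator: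
  assumes "x \<in> carrier G" "y \<in> carrier G" "y \<otimes> y = \<one>"
  shows "commutator G (commutator G x y) y = inv (commutator G x y) \<otimes> inv (commutator G x y)"
    and "commutator G (commutator G y x) y = inv (commutator G y x) \<otimes> inv (commutator G y x)"
proof -
  have y: "inv y = y" using assms by (simp add: inv_equality)
  have c: "y \<otimes> (y \<otimes> z) = z" if "z \<in> carrier G" for z
    using assms that by (simp flip: m_assoc)
  show "commutator G (commutator G x y) y = inv (commutator G x y) \<otimes> inv (commutator G x y)"
    and "commutator G (commutator G y x) y = inv (commutator G y x) \<otimes> inv (commutator G y x)"
    using assms by (simp_all add: commutator_def m_assoc inv_mult_group y c)
qed


section \<open>The lower central series: normality, descent and weights of commutators\<close>

lemma commutator_in_normal:
  assumes "N \<lhd> G" "a \<in> N" "b \<in> carrier G"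
  shows "commutator G a b \<in> N" "commutator G b a \<in> N"
proof -
  interpret N: normal N G by fact
  have a: "a \<in> carrier G" using assms(2) by simp
  have "inv a \<otimes> (inv b \<otimes> a \<otimes> b) \<in> N"
    using assms N.inv_op_closed1[of b a] by simp
  then show 1: "commutator G a b \<in> N"
    using a assms(3) by (simp add: commutator_def m_assoc)
  then show "commutator G b a \<in> N"
    using N.m_inv_closed inv_commutator[OF a assms(3)] by metis
qed

lemma carrier_normal: "carrier G \<lhd> G"
  by (rule normal_invI[OF subgroup_self]) simp

lemma lower_central_normal: "lower_central G n \<lhd> G"
proof (induction n rule: less_induct)
  case (less n)
  consider "n = 0" | "n = Suc 0" | k where "n = Suc (Suc k)"
    by (metis old.nat.exhaust)
  then show ?case
  proof cases
    case 3
    interpret K: normal "lower_central G (Suc k)" G using less 3 by simp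
    show ?thesis unfolding 3 lower_central.simps
    proof (rule normal_generateI)
      show "{commutator G a b |a b. a \<in> lower_central G (Suc k) \<and> b \<in> carrier G} \<subseteq> carrier G"
        by auto
      fix h g
      assume h: "h \<in> {commutator G a b |a b. a \<in> lower_central G (Suc k) \<and> b \<in> carrier G}"
        and g: "g \<in> carrier G"
      then obtain a b where ab: "a \<in> lower_central G (Suc k)" "b \<in> carrier G" "h = commutator G a b"
        by auto
      have "g \<otimes> h \<otimes> inv g = commutator G (g \<otimes> a \<otimes> inv g) (g \<otimes> b \<otimes> inv g)"
        using ab g by (simp add: conj_commutator)
      moreover have "g \<otimes> a \<otimes> inv g \<in> lower_central G (Suc k)"
        using ab g by (simp add: K.inv_op_closed2)
      ultimately show "g \<otimes> h \<otimes> inv g \<in>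
          {commutator G a b |a b. a \<in> lower_central G (Suc k) \<and> b \<in> carrier G}"
        using ab g by blast
    qed
  qed (simp_all add: carrier_normal)
qed

lemma lower_central_closed [simp]: "x \<in> lower_central G n \<Longrightarrow> x \<in> carrier G"
  by (rule subgroup.mem_carrier[OF normal_imp_subgroup[OF lower_central_normal]])

lemma lower_central_subgroup: "subgroup (lower_central G n) G"
  by (simp add: lower_central_normal normal_imp_subgroup)

lemma lower_central_Suc_subset: "lower_central G (Suc n) \<subseteq> lower_central G n"
proof (cases n)
  case (Suc k)
  have "{commutator G a b |a b. a \<in> lower_central G n \<and> b \<in> carrier G} \<subseteq> lower_central G n"
    using commutator_in_normal[OF lower_central_normal] by auto
  then show ?thesis
    using Suc by (simp add: generate_subgroup_incl lower_central_subgroup)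
qed simp

lemma lower_central_antimono: "m \<le> n \<Longrightarrow> lower_central G n \<subseteq> lower_central G m"
  by (rule lift_Suc_antimono_le[of "lower_central G"]) (use lower_central_Suc_subset in auto)

lemma lower_central_mono: "x \<in> lower_central G n \<Longrightarrow> m \<le> n \<Longrightarrow> x \<in> lower_central G m"
  using lower_central_antimono by blast

lemma commutator_in_Suc:
  assumes "n > 0" "a \<in> lower_central G n" "b \<in> carrier G"
  shows "commutator G a b \<in> lower_central G (Suc n)"
proof -
  obtain k where "n = Suc k" using assms(1) by (cases n) auto
  then show ?thesis using assms by (auto intro: generate.incl)
qed

lemma commutator_one [simp]:
  "x \<in> carrier G \<Longrightarrow> commutator G x \<one> = \<one>" "x \<in> carrier G \<Longrightarrow> commutator G \<one> x = \<one>"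
  by (simp_all add: commutator_def)

text \<open>The condition says that y commutes with x modulo N: this is a centraliser in G / N,
  pulled back and cut down to H. It allows a bound on commutators to be checked on a generating
  set.\<close>

lemma commutator_right_subgroup:
  assumes N: "N \<lhd> G" and x: "x \<in> carrier G" and H: "subgroup H G"
  shows "subgroup {y \<in> H. commutator G x y \<in> N} G"
proof -
  interpret N: normal N G by fact
  interpret H: subgroup H G by fact
  show ?thesis
  proof (rule subgroupI)
    have "\<one> \<in> {y \<in> H. commutator G x y \<in> N}" using x by simp
    then show "{y \<in> H. commutator G x y \<in> N} \<noteq> {}" by fast
  next
    fix y assume y: "y \<in> {y \<in> H. commutator G x y \<in> N}"
    then have yc: "y \<in> carrier G" by auto
    have "commutator G x (inv y) = y \<otimes> inv (commutator G x y) \<otimes> inv y"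
      using x yc by (simp add: commutator_def m_assoc inv_mult_group)
    then show "inv y \<in> {y \<in> H. commutator G x y \<in> N}"
      using y yc by (simp add: N.inv_op_closed2)
  next
    fix y z assume y: "y \<in> {y \<in> H. commutator G x y \<in> N}" and z: "z \<in> {y \<in> H. commutator G x y \<in> N}"
    then have "commutator G (commutator G x y) z \<in> N"
      using commutator_in_normal(1)[OF N] by auto
    moreover have "commutator G x (y \<otimes> z) =
        commutator G x z \<otimes> commutator G x y \<otimes> commutator G (commutator G x y) z"
      using x y z by (intro commutator_mult_right) auto
    ultimately show "y \<otimes> z \<in> {y \<in> H. commutator G x y \<in> N}"
      using y z by simp
  qed (use H.subset in blast)
qed

text \<open>Three subgroups argument by induction on the weight of the right entry. For a generator
  (b, c) of the next term, the other two factors of the Hall-Witt identity only involve right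
  entries of weight m; one needs the hypothesis for n, the other for n + 1, hence the induction
  keeps n general.\<close>

lemma commutator_lower_central:
  "\<lbrakk>n > 0; m > 0; x \<in> lower_central G n; y \<in> lower_central G m\<rbrakk>
    \<Longrightarrow> commutator G x y \<in> lower_central G (n + m)"
proof (induction m arbitrary: n x y)
  case (Suc m)
  show ?case
  proof (cases m)
    case 0
    then show ?thesis using Suc by (simp add: commutator_in_Suc)
  next
    case (Suc k)
    let ?N = "lower_central G (n + Suc m)"
    interpret N: normal ?N G by (rule lower_central_normal)
    have x: "x \<in> carrier G" using Suc.prems by simp
    have "{commutator G b c |b c. b \<in> lower_central G m \<and> c \<in> carrier G} \<subseteq>
        {y \<in> carrier G. commutator G x y \<in> ?N}"
    proof (clarify, intro conjI)
      fix b c assume b: "b \<in> lower_central G m" and c: "c \<in> carrier G"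
      then have bc: "b \<in> carrier G" by simp
      show "commutator G b c \<in> carrier G" using bc c by simp
      have ib: "inv b \<in> lower_central G m"
        using b by (simp add: lower_central_subgroup subgroup.m_inv_closed)
      have ix: "inv x \<in> lower_central G n"
        using Suc.prems by (simp add: lower_central_subgroup subgroup.m_inv_closed)
      \<comment> \<open>The Hall-Witt identity is taken at the inverse of c, so that the middle
        factor \<open>q\<close> is a conjugate of the double commutator ((b, c), x) that is to be
        bounded.\<close>
      define p where "p = inv b \<otimes> commutator G (commutator G x (inv b)) (inv c) \<otimes> b"
      define q where "q = c \<otimes> commutator G (commutator G b c) x \<otimes> inv c"
      define r where "r = inv x \<otimes> commutator G (commutator G (inv c) (inv x)) b \<otimes> x"
      have hw: "p \<otimes> q \<otimes> r = \<one>"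
        unfolding p_def q_def r_def using Hall_Witt[of x b "inv c"] x bc c by simp
      have "commutator G x (inv b) \<in> lower_central G (n + m)"
        using Suc.IH[OF Suc.prems(1) _ Suc.prems(3) ib] Suc by simp
      then have "commutator G (commutator G x (inv b)) (inv c) \<in> ?N"
        using commutator_in_Suc[of "n + m"] Suc.prems(1) c by simp
      then have p: "p \<in> ?N" unfolding p_def by (rule N.inv_op_closed1[OF bc])
      have "commutator G (inv x) (inv c) \<in> lower_central G (Suc n)"
        using commutator_in_Suc ix Suc.prems(1) c by simp
      then have "commutator G (inv c) (inv x) \<in> lower_central G (Suc n)"
        using subgroup.m_inv_closed[OF lower_central_subgroup] inv_commutator[of "inv x" "inv c"] x c
        by fastforce
      then have "commutator G (commutator G (inv c) (inv x)) b \<in> ?N"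
        using Suc.IH[of "Suc n" _ b] b Suc by simp
      then have r: "r \<in> ?N" unfolding r_def by (rule N.inv_op_closed1[OF x])
      have carr: "p \<in> carrier G" "q \<in> carrier G" "r \<in> carrier G"
        using x bc c by (auto simp: p_def q_def r_def)
      have "q = inv p \<otimes> (p \<otimes> q \<otimes> r) \<otimes> inv r"
        using carr by (simp add: m_assoc)
      then have q: "q \<in> ?N"
        using N.m_closed[OF N.m_inv_closed[OF p] N.m_inv_closed[OF r]] carr by (simp add: hw)
      have "commutator G (commutator G b c) x = inv c \<otimes> q \<otimes> c"
        using x bc c by (simp add: q_def m_assoc)
      then have "commutator G (commutator G b c) x \<in> ?N"
        using N.inv_op_closed1[OF c q] by simp
      then show "commutator G x (commutator G b c) \<in> ?N"
        using x bc c inv_commutator[of "commutator G b c" x] N.m_inv_closed by fastforce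
    qed
    then have "generate G {commutator G b c |b c. b \<in> lower_central G m \<and> c \<in> carrier G} \<subseteq>
        {y \<in> carrier G. commutator G x y \<in> ?N}"
      by (rule generate_subgroup_incl)
        (intro commutator_right_subgroup N.normal_axioms x subgroup_self)
    then show ?thesis using Suc.prems Suc by auto
  qed
qed simp

section \<open>The graded pieces as abelian groups of classes\<close>

lemma Lie_component_carrier: "carrier (Lie_component G k) = Lie_class G k ` lower_central G k"
  by (auto simp: Lie_component_def Lie_class_def FactGroup_def RCOSETS_def r_coset_def)

lemma Lie_class_in_carrier [simp]:
  "x \<in> lower_central G k \<Longrightarrow> Lie_class G k x \<in> carrier (Lie_component G k)"
  by (simp add: Lie_component_carrier)

lemma lower_central_normal_Suc:
  "lower_central G (Suc k) \<lhd> G\<lparr>carrier := lower_central G k\<rparr>"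
  by (intro normal_restrict_supergroup lower_central_subgroup lower_central_normal lower_central_Suc_subset)

lemma Lie_component_group: "group (Lie_component G k)"
  unfolding Lie_component_def by (rule normal.factorgroup_is_group[OF lower_central_normal_Suc])

lemma Lie_class_mult:
  assumes "x \<in> lower_central G k" "y \<in> lower_central G k"
  shows "Lie_class G k (x \<otimes> y) = Lie_class G k x \<otimes>\<^bsub>Lie_component G k\<^esub> Lie_class G k y"
  using normal.rcos_sum[OF lower_central_normal[of "Suc k"], of x y] assms
  by (simp add: Lie_class_def Lie_component_def FactGroup_def set_mult_def)

lemma Lie_class_eq_iff:
  assumes "x \<in> carrier G" "y \<in> carrier G"
  shows "Lie_class G k x = Lie_class G k y \<longleftrightarrow> x \<otimes> inv y \<in> lower_central G (Suc k)"
proof -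
  interpret N: normal "lower_central G (Suc k)" G by (rule lower_central_normal)
  show ?thesis unfolding Lie_class_def
    using assms rcos_self[OF assms(1) N.subgroup_axioms] repr_independence[OF _ assms(2) N.subgroup_axioms]
      N.rcos_module[OF group_axioms assms(2,1)] by metis
qed

lemma Lie_class_one: "Lie_class G k \<one> = \<one>\<^bsub>Lie_component G k\<^esub>"
  by (simp add: Lie_class_def Lie_component_def FactGroup_def coset_mult_one lower_central_subgroup subgroup.subset)

lemma Lie_class_eq_one_iff:
  assumes "x \<in> carrier G"
  shows "Lie_class G k x = \<one>\<^bsub>Lie_component G k\<^esub> \<longleftrightarrow> x \<in> lower_central G (Suc k)"
  using Lie_class_eq_iff[OF assms one_closed, of k] assms by (simp add: Lie_class_one)

lemma Lie_class_trivial [simp]: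
  "x \<in> lower_central G (Suc k) \<Longrightarrow> Lie_class G k x = \<one>\<^bsub>Lie_component G k\<^esub>"
  by (simp add: Lie_class_eq_one_iff)

lemma Lie_class_inv:
  assumes "x \<in> lower_central G k"
  shows "Lie_class G k (inv x) = inv\<^bsub>Lie_component G k\<^esub> Lie_class G k x"
proof -
  interpret A: group "Lie_component G k" by (rule Lie_component_group)
  have i: "inv x \<in> lower_central G k"
    using assms by (simp add: lower_central_subgroup subgroup.m_inv_closed)
  have "Lie_class G k (inv x) \<otimes>\<^bsub>Lie_component G k\<^esub> Lie_class G k x = \<one>\<^bsub>Lie_component G k\<^esub>"
    using Lie_class_mult[OF i assms] assms by (simp add: Lie_class_one)
  then show ?thesis using A.inv_equality i assms by simp
qed

lemma Lie_component_comm_group: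
  assumes "k > 0"
  shows "comm_group (Lie_component G k)"
proof (rule group.group_comm_groupI[OF Lie_component_group])
  fix X Y assume "X \<in> carrier (Lie_component G k)" "Y \<in> carrier (Lie_component G k)"
  then obtain x y where xy: "x \<in> lower_central G k" "y \<in> lower_central G k"
    and X: "X = Lie_class G k x" and Y: "Y = Lie_class G k y"
    by (auto simp: Lie_component_carrier)
  interpret A: group "Lie_component G k" by (rule Lie_component_group)
  have "commutator G x y \<in> lower_central G (Suc k)"
    using commutator_in_Suc assms xy by simp
  then have "Lie_class G k (y \<otimes> x) = Lie_class G k (y \<otimes> x \<otimes> commutator G x y)"
    using xy Lie_class_mult[of "y \<otimes> x" k "commutator G x y"]
    by (simp add: lower_central_mono[of _ "Suc k" k] subgroup.m_closed[OF lower_central_subgroup])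
  then show "X \<otimes>\<^bsub>Lie_component G k\<^esub> Y = Y \<otimes>\<^bsub>Lie_component G k\<^esub> X"
    using xy by (simp add: X Y flip: Lie_class_mult mult_commutator)
qed

section \<open>Additivity, well-definedness and Jacobi identity of the graded bracket\<close>

lemma commutator_lower_central_le:
  "\<lbrakk>n > 0; m > 0; x \<in> lower_central G n; y \<in> lower_central G m; k \<le> n + m\<rbrakk>
    \<Longrightarrow> commutator G x y \<in> lower_central G k"
  using commutator_lower_central lower_central_mono by blast

text \<open>The correction ((x, y), x') has weight n + m + n' > k and vanishes in degree k. The
  weights may exceed what k requires, so the rule also covers a product with one factor so deep that
  it contributes nothing.\<close>

lemma Lie_class_commutator_mult_left:
  assumes x: "x \<in> lower_central G n" and x': "x' \<in> lower_central G n'" and y: "y \<in> lower_central G m"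
    and pos: "n > 0" "n' > 0" "m > 0"
    and k: "k \<le> n + m" "k \<le> n' + m" "k < n + m + n'"
  shows "Lie_class G k (commutator G (x \<otimes> x') y) =
    Lie_class G k (commutator G x y) \<otimes>\<^bsub>Lie_component G k\<^esub> Lie_class G k (commutator G x' y)"
proof -
  interpret A: group "Lie_component G k" by (rule Lie_component_group)
  have 1: "commutator G x y \<in> lower_central G k" "commutator G x' y \<in> lower_central G k"
    using assms by (auto intro: commutator_lower_central_le)
  have 2: "commutator G (commutator G x y) x' \<in> lower_central G (Suc k)"
    using commutator_lower_central_le[OF _ pos(2) commutator_lower_central[OF pos(1,3) x y] x'] k pos by simp
  then have 3: "commutator G (commutator G x y) x' \<in> lower_central G k"
    by (rule lower_central_mono) simp
  show ?thesis
    using x x' y 1 2 3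
    by (simp add: commutator_mult_left Lie_class_mult subgroup.m_closed[OF lower_central_subgroup]
        Lie_class_eq_one_iff)
qed

lemma Lie_class_commutator_mult_right:
  assumes x: "x \<in> lower_central G n" and y: "y \<in> lower_central G m" and y': "y' \<in> lower_central G m'"
    and pos: "n > 0" "m > 0" "m' > 0"
    and k: "k \<le> n + m" "k \<le> n + m'" "k < n + m + m'"
  shows "Lie_class G k (commutator G x (y \<otimes> y')) =
    Lie_class G k (commutator G x y') \<otimes>\<^bsub>Lie_component G k\<^esub> Lie_class G k (commutator G x y)"
proof -
  interpret A: group "Lie_component G k" by (rule Lie_component_group)
  have 1: "commutator G x y \<in> lower_central G k" "commutator G x y' \<in> lower_central G k"
    using assms by (auto intro: commutator_lower_central_le)
  have 2: "commutator G (commutator G x y) y' \<in> lower_central G (Suc k)"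
    using commutator_lower_central_le[OF _ pos(3) commutator_lower_central[OF pos(1,2) x y] y'] k pos by simp
  then have 3: "commutator G (commutator G x y) y' \<in> lower_central G k"
    by (rule lower_central_mono) simp
  show ?thesis
    using x y y' 1 2 3
    by (simp add: commutator_mult_right Lie_class_mult subgroup.m_closed[OF lower_central_subgroup]
        Lie_class_eq_one_iff)
qed

text \<open>Another representative differs by an element one step deeper, and by additivity this
  changes the commutator only in weight k + l + 1. Hence all sets in the union defining
  \<open>Lie_bracket\<close> coincide.\<close>

lemma Lie_bracket_Lie_class:
  assumes "k > 0" "l > 0" "a \<in> lower_central G k" "b \<in> lower_central G l"
  shows "Lie_bracket G k l (Lie_class G k a) (Lie_class G l b) = Lie_class G (k + l) (commutator G a b)"
proof -
  interpret A: group "Lie_component G (k + l)" by (rule Lie_component_group)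
  have *: "Lie_class G (k + l) (commutator G a' b') = Lie_class G (k + l) (commutator G a b)"
    if a': "a' \<in> Lie_class G k a" and b': "b' \<in> Lie_class G l b" for a' b'
  proof -
    obtain n where n: "n \<in> lower_central G (Suc k)" "a' = n \<otimes> a"
      using a' by (auto simp: Lie_class_def r_coset_def)
    obtain m where m: "m \<in> lower_central G (Suc l)" "b' = m \<otimes> b"
      using b' by (auto simp: Lie_class_def r_coset_def)
    have b'l: "b' \<in> lower_central G l"
      using m assms lower_central_mono[OF m(1), of l] subgroup.m_closed[OF lower_central_subgroup] by simp
    have mem: "commutator G a b \<in> lower_central G (k + l)" "commutator G a b' \<in> lower_central G (k + l)"
      using assms b'l by (auto intro: commutator_lower_central)
    have "commutator G n b' \<in> lower_central G (Suc (k + l))"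
      using commutator_lower_central_le[of "Suc k" l n b' "Suc (k + l)"] n b'l assms by simp
    then have "Lie_class G (k + l) (commutator G a' b') = Lie_class G (k + l) (commutator G a b')"
      using Lie_class_commutator_mult_left[of n "Suc k" a k b' l "k + l"] n assms b'l mem
      by simp
    moreover have "commutator G a m \<in> lower_central G (Suc (k + l))"
      using commutator_lower_central_le[of k "Suc l" a m "Suc (k + l)"] m assms by simp
    then have "Lie_class G (k + l) (commutator G a b') = Lie_class G (k + l) (commutator G a b)"
      using Lie_class_commutator_mult_right[of a k m "Suc l" b l "k + l"] m assms mem
      by simp
    ultimately show ?thesis by simp
  qed
  have "a \<in> Lie_class G k a" "b \<in> Lie_class G l b"
    using assms by (simp_all add: Lie_class_def rcos_self lower_central_subgroup)
  then show ?thesis unfolding Lie_bracket_def using * by blast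
qed

lemma Lie_class_commutator_inv_left:
  assumes "x \<in> lower_central G n" "y \<in> lower_central G m" "n > 0" "m > 0" "k \<le> n + m" "k < n + m + n"
  shows "Lie_class G k (commutator G (inv x) y) = inv\<^bsub>Lie_component G k\<^esub> Lie_class G k (commutator G x y)"
proof -
  interpret A: group "Lie_component G k" by (rule Lie_component_group)
  have ix: "inv x \<in> lower_central G n"
    using assms by (simp add: lower_central_subgroup subgroup.m_inv_closed)
  have "commutator G x y \<in> lower_central G k" "commutator G (inv x) y \<in> lower_central G k"
    using assms ix by (auto intro: commutator_lower_central_le)
  then show ?thesis
    using Lie_class_commutator_mult_left[OF ix assms(1,2,3,3,4,5,5,6)] assms
    by (simp add: Lie_class_one A.inv_equality)
qed

lemma Lie_class_commutator_swap_left: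
  assumes "x \<in> lower_central G p" "y \<in> lower_central G q" "z \<in> lower_central G r"
    and "p > 0" "q > 0" "r > 0"
  shows "Lie_class G (p + q + r) (commutator G (commutator G y x) z) =
    inv\<^bsub>Lie_component G (p + q + r)\<^esub> Lie_class G (p + q + r) (commutator G (commutator G x y) z)"
proof -
  have "commutator G y x = inv (commutator G x y)"
    using assms by (simp add: inv_commutator)
  then show ?thesis
    using Lie_class_commutator_inv_left[OF commutator_lower_central[OF assms(4,5,1,2)] assms(3), of "p + q + r"]
      assms by simp
qed

lemma Lie_class_conj:
  assumes "x \<in> lower_central G k" "y \<in> carrier G" "k > 0"
  shows "Lie_class G k (inv y \<otimes> x \<otimes> y) = Lie_class G k x"
proof -
  interpret A: group "Lie_component G k" by (rule Lie_component_group)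
  have "inv y \<otimes> x \<otimes> y = x \<otimes> commutator G x y"
    using assms by (simp add: commutator_def m_assoc)
  moreover have "commutator G x y \<in> lower_central G (Suc k)"
    using assms by (simp add: commutator_in_Suc)
  ultimately show ?thesis
    using assms by (simp add: Lie_class_mult Lie_class_eq_one_iff lower_central_mono[of _ "Suc k" k])
qed

text \<open>The product (x, y^-1)(x, y) is the inverse of ((x, y), y^-1), which has weight p + 2q,
  so its commutator with z vanishes in degree p + q + r. The sign rule is called for by the inverted
  entries in the Hall-Witt identity.\<close>

lemma Lie_class_commutator_inv_middle:
  assumes x: "x \<in> lower_central G p" and y: "y \<in> lower_central G q" and z: "z \<in> lower_central G r"
    and pos: "p > 0" "q > 0" "r > 0"
  shows "Lie_class G (p + q + r) (commutator G (commutator G x (inv y)) z) =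
    inv\<^bsub>Lie_component G (p + q + r)\<^esub> Lie_class G (p + q + r) (commutator G (commutator G x y) z)"
proof -
  interpret A: group "Lie_component G (p + q + r)" by (rule Lie_component_group)
  have iy: "inv y \<in> lower_central G q"
    using assms by (simp add: lower_central_subgroup subgroup.m_inv_closed)
  let ?u = "commutator G x (inv y)" and ?v = "commutator G x y"
  have u: "?u \<in> lower_central G (p + q)" and v: "?v \<in> lower_central G (p + q)"
    using assms iy by (auto intro: commutator_lower_central)
  have "commutator G ?v (inv y) \<in> lower_central G (p + q + q)"
    using commutator_lower_central[OF _ pos(2) v iy] pos by simp
  moreover have "?u \<otimes> ?v \<otimes> commutator G ?v (inv y) = \<one>"
    using commutator_mult_right[of x y "inv y"] x y by simp
  then have "?u \<otimes> ?v = inv (commutator G ?v (inv y))"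
    using x y by (simp add: inv_equality inv_solve_right')
  ultimately have uv: "?u \<otimes> ?v \<in> lower_central G (p + q + q)"
    by (simp add: lower_central_subgroup subgroup.m_inv_closed)
  have "commutator G (?u \<otimes> ?v) z \<in> lower_central G (Suc (p + q + r))"
    using commutator_lower_central_le[OF _ pos(3) uv z] pos by simp
  then have "Lie_class G (p + q + r) (commutator G ?u z) \<otimes>\<^bsub>Lie_component G (p + q + r)\<^esub>
      Lie_class G (p + q + r) (commutator G ?v z) = \<one>\<^bsub>Lie_component G (p + q + r)\<^esub>"
    using Lie_class_commutator_mult_left[OF u v z, of "p + q + r"] pos x y z
    by simp
  then show ?thesis
    using A.inv_equality commutator_lower_central[OF _ pos(3) u z]
      commutator_lower_central[OF _ pos(3) v z] pos by simp
qed

lemma Lie_class_Jacobi: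
  assumes x: "x \<in> lower_central G p" and y: "y \<in> lower_central G q" and z: "z \<in> lower_central G r"
    and pos: "p > 0" "q > 0" "r > 0" and k: "k = p + q + r"
  shows "Lie_class G k (commutator G (commutator G x y) z) \<otimes>\<^bsub>Lie_component G k\<^esub>
    Lie_class G k (commutator G (commutator G y z) x) \<otimes>\<^bsub>Lie_component G k\<^esub>
    Lie_class G k (commutator G (commutator G z x) y) = \<one>\<^bsub>Lie_component G k\<^esub>"
proof -
  interpret A: comm_group "Lie_component G k" using Lie_component_comm_group pos k by simp
  let ?L = "Lie_class G k"
  define P Q R where "P = commutator G (commutator G x (inv y)) z"
    and "Q = commutator G (commutator G y (inv z)) x"
    and "R = commutator G (commutator G z (inv x)) y"
  have i: "inv x \<in> lower_central G p" "inv y \<in> lower_central G q" "inv z \<in> lower_central G r"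
    using assms by (simp_all add: lower_central_subgroup subgroup.m_inv_closed)
  have mem: "commutator G (commutator G a b) c \<in> lower_central G k"
    if "a \<in> lower_central G p'" "b \<in> lower_central G q'" "c \<in> lower_central G r'"
      "p' > 0" "q' > 0" "r' > 0" "k = p' + q' + r'" for a b c p' q' r'
    using that commutator_lower_central[OF _ that(6) commutator_lower_central[OF that(4,5,1,2)] that(3)] by simp
  have PQR: "P \<in> lower_central G k" "Q \<in> lower_central G k" "R \<in> lower_central G k"
    using mem[OF x i(2) z] mem[OF y i(3) x] mem[OF z i(1) y] pos k by (simp_all add: P_def Q_def R_def)
  have xyz: "x \<in> carrier G" "y \<in> carrier G" "z \<in> carrier G" using x y z by simp_all
  have conj: "inv g \<otimes> h \<otimes> g \<in> lower_central G k" if "h \<in> lower_central G k" "g \<in> carrier G" for g h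
    using normal.inv_op_closed1[OF lower_central_normal that(2,1)] .
  have "?L P \<otimes>\<^bsub>Lie_component G k\<^esub> ?L Q \<otimes>\<^bsub>Lie_component G k\<^esub> ?L R =
      ?L ((inv y \<otimes> P \<otimes> y) \<otimes> (inv z \<otimes> Q \<otimes> z) \<otimes> (inv x \<otimes> R \<otimes> x))"
    using PQR xyz conj pos k
    by (simp only: Lie_class_mult Lie_class_conj subgroup.m_closed[OF lower_central_subgroup])
  also have "\<dots> = \<one>\<^bsub>Lie_component G k\<^esub>"
    using Hall_Witt[OF xyz] by (simp add: P_def Q_def R_def Lie_class_one)
  finally have 1: "?L P \<otimes>\<^bsub>Lie_component G k\<^esub> ?L Q \<otimes>\<^bsub>Lie_component G k\<^esub> ?L R = \<one>\<^bsub>Lie_component G k\<^esub>" .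
  have 2: "?L P = inv\<^bsub>Lie_component G k\<^esub> ?L (commutator G (commutator G x y) z)"
    "?L Q = inv\<^bsub>Lie_component G k\<^esub> ?L (commutator G (commutator G y z) x)"
    "?L R = inv\<^bsub>Lie_component G k\<^esub> ?L (commutator G (commutator G z x) y)"
    using Lie_class_commutator_inv_middle[OF x y z pos]
      Lie_class_commutator_inv_middle[OF y z x pos(2,3,1)]
      Lie_class_commutator_inv_middle[OF z x y pos(3,1,2)]
    by (simp_all add: P_def Q_def R_def k ac_simps)
  have "commutator G (commutator G x y) z \<in> lower_central G k"
    "commutator G (commutator G y z) x \<in> lower_central G k"
    "commutator G (commutator G z x) y \<in> lower_central G k"
    using mem[OF x y z] mem[OF y z x] mem[OF z x y] pos k by simp_all
  then show ?thesis
    using 1 unfolding 2 by (metis A.inv_mult A.inv_eq_1_iff A.m_closed Lie_class_in_carrier A.inv_closed)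
qed

text \<open>Commutators are additive in each entry modulo
  \<open>lower_central G (Suc (Suc k))\<close>, so products and inverses of generators give nothing
  new. That term is part of the generating set, so that every correction is absorbed at
  once.\<close>

lemma lower_central_generated_Suc:
  assumes k: "k > 0" and X: "X \<subseteq> lower_central G k"
    and gX: "lower_central G k = generate G (X \<union> lower_central G (Suc k))"
    and Y: "Y \<subseteq> carrier G" and gY: "generate G Y = carrier G"
  shows "lower_central G (Suc k) =
    generate G ({commutator G a b |a b. a \<in> X \<and> b \<in> Y} \<union> lower_central G (Suc (Suc k)))"
    (is "_ = generate G ?Z")
proof
  obtain k' where k': "k = Suc k'" using k by (cases k) auto
  have Z: "?Z \<subseteq> lower_central G (Suc k)"
  proof -
    have "commutator G a b \<in> lower_central G (Suc k)" if "a \<in> X" "b \<in> Y" for a b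
      using that X Y k by (auto intro!: commutator_in_Suc)
    then show ?thesis using lower_central_Suc_subset by blast
  qed
  then show "generate G ?Z \<subseteq> lower_central G (Suc k)"
    by (simp add: generate_subgroup_incl lower_central_subgroup)
  have Zc: "?Z \<subseteq> carrier G" using Z by (meson lower_central_closed subset_eq)
  interpret T: subgroup "generate G ?Z" G by (rule generate_is_subgroup[OF Zc])
  have deep: "z \<in> generate G ?Z" if "z \<in> lower_central G (Suc (Suc k))" for z
    using that by (intro generate.incl) simp
  have T_left: "z \<in> generate G ?Z" if "w \<otimes> z \<in> generate G ?Z" "w \<in> generate G ?Z" "z \<in> carrier G" for w z
    using T.m_closed[OF T.m_inv_closed[OF that(2)] that(1)] that T.mem_carrier by simp
  have xT: "commutator G a b \<in> generate G ?Z" if a: "a \<in> X" and b: "b \<in> carrier G" for a b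
  proof -
    have ak: "a \<in> lower_central G k" using a X by auto
    have "b \<in> generate G Y" using b gY by simp
    then show ?thesis
    proof (induction b rule: generate.induct)
      case one
      then show ?case using ak by (simp add: generate.one)
    next
      case (incl y)
      then show ?case using a by (auto intro: generate.incl)
    next
      case (inv y)
      then have y: "y \<in> carrier G" using Y by auto
      let ?c = "commutator G (commutator G a (inv y)) y"
      have "commutator G a (inv y) \<in> lower_central G (Suc k)"
        using k ak y by (simp add: commutator_in_Suc)
      then have "?c \<in> lower_central G (Suc (Suc k))" using y by (simp add: commutator_in_Suc del: lower_central.simps)
      then have c: "?c \<in> generate G ?Z" by (rule deep)
      have ay: "commutator G a y \<in> generate G ?Z"
        using a inv by (auto intro: generate.incl)
      have "commutator G a y \<otimes> commutator G a (inv y) \<otimes> ?c = \<one>"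
        using commutator_mult_right[of a "inv y" y] ak y by simp
      then have "commutator G a (inv y) = inv (commutator G a y) \<otimes> inv ?c"
        using ak y by (metis commutator_closed inv_closed inv_equality inv_mult_group inv_solve_left lower_central_closed m_assoc m_closed)
      then show ?case using T.m_closed[OF T.m_inv_closed[OF ay] T.m_inv_closed[OF c]] by simp
    next
      case (eng y z)
      then have yz: "y \<in> carrier G" "z \<in> carrier G" using gY by auto
      have "commutator G a y \<in> lower_central G (Suc k)"
        using k ak yz by (simp add: commutator_in_Suc)
      then have "commutator G (commutator G a y) z \<in> lower_central G (Suc (Suc k))"
        using yz by (simp add: commutator_in_Suc del: lower_central.simps)
      from T.m_closed[OF T.m_closed[OF eng.IH(2,1)] deep[OF this]] show ?case
        using yz ak by (simp add: commutator_mult_right)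
    qed
  qed
  have yT: "commutator G a b \<in> generate G ?Z" if "a \<in> X \<union> lower_central G (Suc k)" "b \<in> carrier G" for a b
  proof (cases "a \<in> X")
    case False
    then have "commutator G a b \<in> lower_central G (Suc (Suc k))"
      using that by (intro commutator_in_Suc) auto
    then show ?thesis by (rule deep)
  qed (use xT that in blast)
  have "commutator G a b \<in> generate G ?Z" if a: "a \<in> lower_central G k" and b: "b \<in> carrier G" for a b
  proof -
    have "a \<in> generate G (X \<union> lower_central G (Suc k))" using a gX by simp
    then show ?thesis
    proof (induction a rule: generate.induct)
      case one
      then show ?case using b by (simp add: generate.one)
    next
      case (incl y)
      then show ?case using yT b by blast
    next
      case (inv y)
      then have yk: "y \<in> lower_central G k" using X lower_central_Suc_subset by blast
      have yT: "commutator G y b \<in> generate G ?Z" using inv yT b by blast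
      let ?c = "commutator G (commutator G y b) (inv y)"
      have "commutator G y b \<in> lower_central G (Suc k)"
        using k yk b by (simp add: commutator_in_Suc)
      then have "?c \<in> lower_central G (Suc (Suc k))" using yk by (simp add: commutator_in_Suc del: lower_central.simps)
      then have c: "?c \<in> generate G ?Z" by (rule deep)
      have e: "commutator G y b \<otimes> ?c \<otimes> commutator G (inv y) b = \<one>"
        using commutator_mult_left[of y "inv y" b] yk b by simp
      show ?case
        by (rule T_left[OF _ T.m_closed[OF yT c]]) (use e yk b generate.one in auto)
    next
      case (eng y z)
      then have yz: "y \<in> lower_central G k" "z \<in> lower_central G k" using gX by auto
      have "commutator G y b \<in> lower_central G (Suc k)"
        using k yz b by (simp add: commutator_in_Suc)
      then have "commutator G (commutator G y b) z \<in> lower_central G (Suc (Suc k))"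
        using yz by (simp add: commutator_in_Suc del: lower_central.simps)
      from T.m_closed[OF T.m_closed[OF eng.IH(1) deep[OF this]] eng.IH(2)] show ?case
        using yz b by (simp add: commutator_mult_left)
    qed
  qed
  then have "{commutator G a b |a b. a \<in> lower_central G k \<and> b \<in> carrier G} \<subseteq> generate G ?Z"
    by fast
  then have "generate G {commutator G a b |a b. a \<in> lower_central G k \<and> b \<in> carrier G} \<subseteq> generate G ?Z"
    by (rule generate_subgroup_incl[OF _ T.subgroup_axioms])
  then show "lower_central G (Suc k) \<subseteq> generate G ?Z"
    by (simp only: k' lower_central.simps)
qed

end

section \<open>Degree four in a group generated by involutions\<close>

definition comm_letters :: "(nat \<times> nat) list \<Rightarrow> nat \<Rightarrow> nat \<Rightarrow> bool" where
  "comm_letters es a b \<longleftrightarrow> a = b \<or> (a, b) \<in> set es \<or> (b, a) \<in> set es"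

type_synonym quad = "nat \<times> nat \<times> nat \<times> nat"

text \<open>A quadruple \<open>(a, b, c, d)\<close> stands for the left-nested bracket of four generators.  Each list below
  sums to zero in degree 4: the Jacobi identity in degree 3 bracketed with a letter, the expansion of
  \<open>[[a, b], [c, d]] = [[c, d], [a, b]]\<close>, the identity \<open>[[a, b], [a, b]] = 0\<close>, and the consequences of
  \<open>(u, x, x) = (u, x)\<^sup>-\<^sup>2\<close> for an involution \<open>x\<close>.\<close>

definition Lie_relations :: "nat \<Rightarrow> quad list list" where
  "Lie_relations m =
     [[(a, b, c, d), (b, c, a, d), (c, a, b, d)]. a \<leftarrow> [0..<m], b \<leftarrow> [0..<a], c \<leftarrow> [0..<b], d \<leftarrow> [0..<m]] @
     [[(a, b, c, d), (a, b, d, c), (c, d, a, b), (c, d, b, a)]. a \<leftarrow> [0..<m], b \<leftarrow> [0..<a], c \<leftarrow> [0..<Suc a], d \<leftarrow> [0..<c]] @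
     [[(a, b, a, b), (a, b, b, a)]. a \<leftarrow> [0..<m], b \<leftarrow> [0..<a]] @
     [[(a, b, a, d), (a, b, d, d)]. a \<leftarrow> [0..<m], b \<leftarrow> [0..<m], d \<leftarrow> [0..<m]] @
     [[(a, b, b, d), (a, b, d, d)]. a \<leftarrow> [0..<m], b \<leftarrow> [0..<a], d \<leftarrow> [0..<m]]"

text \<open>A bracket is known if it vanishes because its first two letters commute, or if it occurs
  in \<open>S\<close> up to exchanging these letters, which is harmless in exponent 2.\<close>

fun known :: "(nat \<times> nat) list \<Rightarrow> quad list \<Rightarrow> quad \<Rightarrow> bool" where
  "known es S (a, b, c, d) \<longleftrightarrow>
     comm_letters es a b \<or> (a, b, c, d) \<in> set S \<or> (b, a, c, d) \<in> set S"

text \<open>A relation all of whose terms but one are known yields the last one.  For the generating sets at hand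
  this propagation already reaches everything, so no linear algebra is needed.\<close>

definition deduce :: "(nat \<times> nat) list \<Rightarrow> quad list \<Rightarrow> quad list \<Rightarrow> quad list" where
  "deduce es r S = (case filter (\<lambda>w. \<not> known es S w) r of [w] \<Rightarrow> w # S | _ \<Rightarrow> S)"

definition all_known :: "(nat \<times> nat) list \<Rightarrow> nat \<Rightarrow> quad list \<Rightarrow> bool" where
  "all_known es m S \<longleftrightarrow>
     list_all (known es S) [(a, b, c, d). a \<leftarrow> [0..<m], b \<leftarrow> [0..<a], c \<leftarrow> [0..<m], d \<leftarrow> [0..<m]]"

text \<open>The number \<open>n\<close> counts sweeps over the relation table: a relation with two
  unknown terms yields nothing in one sweep but may yield a term in the next.\<close>

definition spans :: "(nat \<times> nat) list \<Rightarrow> nat \<Rightarrow> nat \<Rightarrow> quad list \<Rightarrow> bool" where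
  "spans es m n S \<longleftrightarrow>
     all_known es m (fold (deduce es) (concat (replicate n (Lie_relations m))) S)"

text \<open>The commutations in \<open>es\<close> are relations that hold in G, not a presentation
  of G; what follows therefore bounds degree four from above only.\<close>

locale involution_generated = group +
  fixes x :: "nat \<Rightarrow> 'a" and m :: nat and es :: "(nat \<times> nat) list"
  assumes x_closed: "a < m \<Longrightarrow> x a \<in> carrier G"
    and x_square: "a < m \<Longrightarrow> x a \<otimes> x a = \<one>"
    and x_comm: "a < m \<Longrightarrow> b < m \<Longrightarrow> comm_letters es a b \<Longrightarrow> x a \<otimes> x b = x b \<otimes> x a"
    and x_generate: "generate G (x ` {..<m}) = carrier G"
begin

abbreviation A where "A \<equiv> Lie_component G 4"

fun cls :: "quad \<Rightarrow> 'a set" where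
  "cls (a, b, c, d) =
     Lie_class G 4 (commutator G (commutator G (commutator G (x a) (x b)) (x c)) (x d))"

sublocale A: comm_group A
  by (rule Lie_component_comm_group) simp

section \<open>Brackets of four generators span degree four, which has exponent 2\<close>

lemma x_lower_central: "a < m \<Longrightarrow> x a \<in> lower_central G 1"
  using x_closed by simp

lemma commutators_lower_central:
  assumes "a < m" "b < m"
  shows "commutator G (x a) (x b) \<in> lower_central G 2"
    and "c < m \<Longrightarrow> commutator G (commutator G (x a) (x b)) (x c) \<in> lower_central G 3"
    and "c < m \<Longrightarrow> d < m \<Longrightarrow>
      commutator G (commutator G (commutator G (x a) (x b)) (x c)) (x d) \<in> lower_central G 4"
proof -
  show 2: "commutator G (x a) (x b) \<in> lower_central G 2"
    using assms commutator_in_Suc[of 1 "x a" "x b"] x_closed by (simp add: numeral_2_eq_2)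
  show 3: "c < m \<Longrightarrow> commutator G (commutator G (x a) (x b)) (x c) \<in> lower_central G 3"
    using commutator_in_Suc[OF _ 2, of "x c"] x_closed by (simp add: numeral_3_eq_3 numeral_2_eq_2)
  show "c < m \<Longrightarrow> d < m \<Longrightarrow>
      commutator G (commutator G (commutator G (x a) (x b)) (x c)) (x d) \<in> lower_central G 4"
    using commutator_in_Suc[OF _ 3, of "x d"] x_closed
    by (simp add: eval_nat_numeral)
qed

lemma cls_closed: "\<lbrakk>a < m; b < m; c < m; d < m\<rbrakk> \<Longrightarrow> cls (a, b, c, d) \<in> carrier A"
  using commutators_lower_central(3) by simp

text \<open>An induction principle for \<open>A\<close>. Three rounds of generation by commutators
  show that \<open>lower_central G 4\<close> is generated by fourfold commutators of the
  \<open>x a\<close> and \<open>lower_central G 5\<close>; the preimage of \<open>T\<close> is a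
  subgroup containing both.\<close>

lemma carrier_A_subset:
  assumes T: "subgroup T A"
    and cls: "\<And>a b c d. \<lbrakk>a < m; b < m; c < m; d < m\<rbrakk> \<Longrightarrow> cls (a, b, c, d) \<in> T"
  shows "carrier A \<subseteq> T"
proof -
  define X where "X = x ` {..<m}"
  define C where "C Y = {commutator G a b |a b. a \<in> Y \<and> b \<in> X}" for Y
  have X: "X \<subseteq> carrier G" "generate G X = carrier G"
    using x_closed x_generate by (auto simp: X_def)
  have g1: "lower_central G 1 = generate G (X \<union> lower_central G (Suc 1))"
  proof
    show "lower_central G 1 \<subseteq> generate G (X \<union> lower_central G (Suc 1))"
      using X mono_generate[of X "X \<union> lower_central G (Suc 1)"] by auto
    have "X \<union> lower_central G (Suc 1) \<subseteq> carrier G"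
      using X lower_central_closed by blast
    then show "generate G (X \<union> lower_central G (Suc 1)) \<subseteq> lower_central G 1"
      using generate_incl by simp
  qed
  have C_sub: "C Y \<subseteq> lower_central G (Suc k)" if "Y \<subseteq> lower_central G k" "k > 0" for Y k
    using that X unfolding C_def by (fastforce intro!: commutator_in_Suc)
  have C1: "C X \<subseteq> lower_central G (Suc 1)" and C2: "C (C X) \<subseteq> lower_central G (Suc (Suc 1))"
    and C3: "C (C (C X)) \<subseteq> lower_central G (Suc (Suc (Suc 1)))"
    using X by (intro C_sub; simp)+
  have g2: "lower_central G (Suc 1) = generate G (C X \<union> lower_central G (Suc (Suc 1)))"
    using lower_central_generated_Suc[OF _ _ g1 X] X by (simp add: C_def)
  have g3: "lower_central G (Suc (Suc 1)) = generate G (C (C X) \<union> lower_central G (Suc (Suc (Suc 1))))"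
    using lower_central_generated_Suc[OF _ C1 g2 X] by (simp add: C_def)
  have g4: "lower_central G 4 = generate G (C (C (C X)) \<union> lower_central G 5)"
  proof -
    have "4 = Suc (Suc (Suc 1))" "5 = Suc (Suc (Suc (Suc 1)))" by simp_all
    then show ?thesis
      using lower_central_generated_Suc[OF _ C2 g3 X] by (simp only: C_def)
  qed
  interpret T: subgroup T A by fact
  have "subgroup {g \<in> lower_central G 4. Lie_class G 4 g \<in> T} G"
  proof (rule subgroupI)
    have "\<one> \<in> {g \<in> lower_central G 4. Lie_class G 4 g \<in> T}"
      by (simp add: Lie_class_one subgroup.one_closed[OF lower_central_subgroup])
    then show "{g \<in> lower_central G 4. Lie_class G 4 g \<in> T} \<noteq> {}" by fast
  qed (auto simp: Lie_class_inv Lie_class_mult subgroup.m_inv_closed[OF lower_central_subgroup]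
      subgroup.m_closed[OF lower_central_subgroup])
  moreover have "C (C (C X)) \<union> lower_central G 5 \<subseteq> {g \<in> lower_central G 4. Lie_class G 4 g \<in> T}"
  proof
    fix g assume "g \<in> C (C (C X)) \<union> lower_central G 5"
    then consider "g \<in> C (C (C X))" | "g \<in> lower_central G 5" by blast
    then show "g \<in> {g \<in> lower_central G 4. Lie_class G 4 g \<in> T}"
    proof cases
      case 1
      then obtain a b c d where abcd: "a < m" "b < m" "c < m" "d < m"
        and g: "g = commutator G (commutator G (commutator G (x a) (x b)) (x c)) (x d)"
        by (auto simp: C_def X_def)
      show ?thesis using commutators_lower_central(3)[OF abcd] cls[OF abcd] by (simp add: g)
    next
      case 2
      then have "g \<in> lower_central G (Suc 4)" by simp
      then show ?thesis using lower_central_mono[of g 5 4] 2 by (simp del: lower_central.simps)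
    qed
  qed
  ultimately have "lower_central G 4 \<subseteq> {g \<in> lower_central G 4. Lie_class G 4 g \<in> T}"
    using g4 generate_subgroup_incl by metis
  then show ?thesis by (auto simp: Lie_component_carrier)
qed

text \<open>Elements of order at most 2 form a subgroup because \<open>A\<close> is abelian, so
  brackets of generators suffice. For v = (w, x d) the commutator (v, x d) equals v^-2, and it has
  weight 5.\<close>

lemma square_A:
  assumes "X \<in> carrier A"
  shows "X \<otimes>\<^bsub>A\<^esub> X = \<one>\<^bsub>A\<^esub>"
proof -
  have "subgroup {X \<in> carrier A. X \<otimes>\<^bsub>A\<^esub> X = \<one>\<^bsub>A\<^esub>} A"
  proof (rule A.subgroupI)
    show "{X \<in> carrier A. X \<otimes>\<^bsub>A\<^esub> X = \<one>\<^bsub>A\<^esub>} \<noteq> {}"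
      using A.r_one[OF A.one_closed] A.one_closed by blast
    fix X assume "X \<in> {X \<in> carrier A. X \<otimes>\<^bsub>A\<^esub> X = \<one>\<^bsub>A\<^esub>}"
    then show "inv\<^bsub>A\<^esub> X \<in> {X \<in> carrier A. X \<otimes>\<^bsub>A\<^esub> X = \<one>\<^bsub>A\<^esub>}"
      using A.inv_equality by auto
    fix Y assume "Y \<in> {X \<in> carrier A. X \<otimes>\<^bsub>A\<^esub> X = \<one>\<^bsub>A\<^esub>}"
    with \<open>X \<in> _\<close> have XY: "X \<in> carrier A" "Y \<in> carrier A"
      "X \<otimes>\<^bsub>A\<^esub> X = \<one>\<^bsub>A\<^esub>" "Y \<otimes>\<^bsub>A\<^esub> Y = \<one>\<^bsub>A\<^esub>" by auto
    have "(X \<otimes>\<^bsub>A\<^esub> Y) \<otimes>\<^bsub>A\<^esub> (X \<otimes>\<^bsub>A\<^esub> Y) = (X \<otimes>\<^bsub>A\<^esub> X) \<otimes>\<^bsub>A\<^esub> (Y \<otimes>\<^bsub>A\<^esub> Y)"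
      using XY(1,2) by (simp only: A.m_ac A.m_closed)
    then show "X \<otimes>\<^bsub>A\<^esub> Y \<in> {X \<in> carrier A. X \<otimes>\<^bsub>A\<^esub> X = \<one>\<^bsub>A\<^esub>}"
      using XY by simp
  qed auto
  moreover have "cls (a, b, c, d) \<in> {X \<in> carrier A. X \<otimes>\<^bsub>A\<^esub> X = \<one>\<^bsub>A\<^esub>}"
    if abcd: "a < m" "b < m" "c < m" "d < m" for a b c d
  proof -
    let ?w = "commutator G (commutator G (x a) (x b)) (x c)"
    let ?v = "commutator G ?w (x d)"
    have w: "?w \<in> carrier G" using x_closed abcd by simp
    have v: "?v \<in> lower_central G 4" by (rule commutators_lower_central(3)[OF abcd])
    then have iv: "inv ?v \<in> lower_central G 4"
      by (simp add: lower_central_subgroup subgroup.m_inv_closed)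
    have "inv ?v \<otimes> inv ?v \<in> lower_central G (Suc 4)"
      using commutator_in_Suc[OF _ v, of "x d"] x_closed[OF abcd(4)]
        conj_involution_commutator(1)[OF w x_closed[OF abcd(4)] x_square[OF abcd(4)]] by simp
    then have "inv\<^bsub>A\<^esub> (cls (a, b, c, d)) \<otimes>\<^bsub>A\<^esub> inv\<^bsub>A\<^esub> (cls (a, b, c, d)) = \<one>\<^bsub>A\<^esub>"
      using Lie_class_mult[OF iv iv] Lie_class_inv[OF v]
      by (simp del: lower_central.simps)
    then have "cls (a, b, c, d) \<otimes>\<^bsub>A\<^esub> cls (a, b, c, d) = \<one>\<^bsub>A\<^esub>"
      using A.inv_mult_group[OF cls_closed[OF abcd] cls_closed[OF abcd]] cls_closed[OF abcd]
      by (simp del: cls.simps)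
    then show ?thesis using cls_closed[OF abcd] by simp
  qed
  ultimately show ?thesis using carrier_A_subset assms by blast
qed

lemma inv_A [simp]: "X \<in> carrier A \<Longrightarrow> inv\<^bsub>A\<^esub> X = X"
  using square_A A.inv_equality by simp

section \<open>Relations between the brackets of four generators\<close>

lemma Lie_class_commutator2_mult:
  assumes u: "u \<in> lower_central G 2" and u': "u' \<in> lower_central G 2" and cd: "c < m" "d < m"
  shows "Lie_class G 4 (commutator G (commutator G (u \<otimes> u') (x c)) (x d)) =
    Lie_class G 4 (commutator G (commutator G u (x c)) (x d)) \<otimes>\<^bsub>A\<^esub>
    Lie_class G 4 (commutator G (commutator G u' (x c)) (x d))"
proof -
  note c = x_lower_central[OF cd(1)] and d = x_lower_central[OF cd(2)]
  let ?p = "commutator G u (x c)" and ?q = "commutator G u' (x c)"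
  let ?r = "commutator G ?p u'"
  have p: "?p \<in> lower_central G 3" and q: "?q \<in> lower_central G 3"
    using commutator_lower_central[OF _ _ u c] commutator_lower_central[OF _ _ u' c] by simp_all
  \<comment> \<open>The product rule for (u u', x c) inserts this factor; its weight 3 + 2 makes it
    invisible in degree 4.\<close>
  have r: "?r \<in> lower_central G 5"
    using commutator_lower_central[OF _ _ p u'] by simp
  then have r3: "?r \<in> lower_central G 3" by (rule lower_central_mono) simp
  have rd: "commutator G ?r (x d) \<in> lower_central G (Suc 4)"
    using commutator_lower_central_le[OF _ _ r d, of 5] by simp
  have pd: "commutator G ?p (x d) \<in> lower_central G 4" "commutator G ?q (x d) \<in> lower_central G 4"
    using commutator_lower_central[OF _ _ p d] commutator_lower_central[OF _ _ q d] by simp_all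
  have "commutator G (u \<otimes> u') (x c) = ?p \<otimes> ?r \<otimes> ?q"
    using u u' x_closed cd by (simp add: commutator_mult_left)
  then show ?thesis
    using Lie_class_commutator_mult_left[OF subgroup.m_closed[OF lower_central_subgroup p r3] q d, of 4]
      Lie_class_commutator_mult_left[OF p r3 d, of 4] rd pd by (simp del: lower_central.simps)
qed

lemma Lie_class_commutator2_inv:
  assumes u: "u \<in> lower_central G 2" and cd: "c < m" "d < m"
  shows "Lie_class G 4 (commutator G (commutator G (inv u) (x c)) (x d)) =
    Lie_class G 4 (commutator G (commutator G u (x c)) (x d))"
proof -
  have iu: "inv u \<in> lower_central G 2"
    using u by (simp add: lower_central_subgroup subgroup.m_inv_closed)
  have mem: "commutator G (commutator G v (x c)) (x d) \<in> lower_central G 4" if "v \<in> lower_central G 2" for v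
    using commutator_lower_central[OF _ _ commutator_lower_central[OF _ _ that
      x_lower_central[OF cd(1)]] x_lower_central[OF cd(2)]] by simp
  then have "Lie_class G 4 (commutator G (commutator G (inv u) (x c)) (x d)) =
    inv\<^bsub>A\<^esub> (Lie_class G 4 (commutator G (commutator G u (x c)) (x d)))"
    using Lie_class_commutator2_mult[OF iu u cd, symmetric] u iu x_closed[OF cd(1)] x_closed[OF cd(2)]
    by (simp add: A.inv_equality Lie_class_one del: inv_A)
  then show ?thesis using mem[OF u] by simp
qed

lemma cls_swap:
  assumes "a < m" "b < m" "c < m" "d < m"
  shows "cls (b, a, c, d) = cls (a, b, c, d)"
  using Lie_class_commutator2_inv[OF commutators_lower_central(1)[OF assms(1,2)] assms(3,4)] assms
  by (simp add: inv_commutator x_closed)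

lemma cls_comm:
  assumes "a < m" "b < m" "c < m" "d < m" "comm_letters es a b"
  shows "cls (a, b, c, d) = \<one>\<^bsub>A\<^esub>"
proof -
  have "x b \<otimes> x a \<otimes> commutator G (x a) (x b) = x b \<otimes> x a"
    using assms x_comm[OF assms(1,2,5)] mult_commutator[of "x a" "x b"] x_closed by simp
  then have "commutator G (x a) (x b) = \<one>"
    using assms x_closed by (simp add: l_cancel_one)
  then show ?thesis using assms x_closed by (simp add: Lie_class_one)
qed

text \<open>By the Jacobi identity in degree 3 the three triple commutators multiply into
  \<open>lower_central G 4\<close>, so the commutator of their product with \<open>x d\<close> is
  trivial in degree 4. Additivity then separates the three terms.\<close>

lemma cls_Jacobi3:
  assumes abcd: "a < m" "b < m" "c < m" "d < m"
  shows "cls (a, b, c, d) \<otimes>\<^bsub>A\<^esub> cls (b, c, a, d) \<otimes>\<^bsub>A\<^esub> cls (c, a, b, d) = \<one>\<^bsub>A\<^esub>"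
proof -
  note X = x_lower_central
  define u1 where "u1 = commutator G (commutator G (x a) (x b)) (x c)"
  define u2 where "u2 = commutator G (commutator G (x b) (x c)) (x a)"
  define u3 where "u3 = commutator G (commutator G (x c) (x a)) (x b)"
  have u: "u1 \<in> lower_central G 3" "u2 \<in> lower_central G 3" "u3 \<in> lower_central G 3"
    unfolding u1_def u2_def u3_def using abcd commutators_lower_central(2) by auto
  then have u12: "u1 \<otimes> u2 \<in> lower_central G 3"
    by (simp add: subgroup.m_closed[OF lower_central_subgroup])
  have "Lie_class G 3 (u1 \<otimes> u2 \<otimes> u3) = \<one>\<^bsub>Lie_component G 3\<^esub>"
    using Lie_class_Jacobi[OF X[OF abcd(1)] X[OF abcd(2)] X[OF abcd(3)], of 3] u u12
    by (simp add: Lie_class_mult flip: u1_def u2_def u3_def)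
  then have "u1 \<otimes> u2 \<otimes> u3 \<in> lower_central G (Suc 3)"
    using u by (simp add: Lie_class_eq_one_iff del: lower_central.simps)
  then have "commutator G (u1 \<otimes> u2 \<otimes> u3) (x d) \<in> lower_central G (Suc 4)"
    using commutator_lower_central_le[OF _ _ _ X[OF abcd(4)], of "Suc 3" _ 5]
    by (simp del: lower_central.simps)
  then show ?thesis
    using Lie_class_commutator_mult_left[OF u12 u(3) X[OF abcd(4)], of 4]
      Lie_class_commutator_mult_left[OF u(1,2) X[OF abcd(4)], of 4]
    by (simp del: lower_central.simps flip: u1_def u2_def u3_def)
qed

text \<open>The Jacobi identity for (a, b), c and d, with (a, b) treated as a single entry of weight
  2; all signs disappear in exponent 2.\<close>

lemma cls_Jacobi2:
  assumes abcd: "a < m" "b < m" "c < m" "d < m"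
  shows "cls (a, b, c, d) \<otimes>\<^bsub>A\<^esub> cls (a, b, d, c) =
    Lie_class G 4 (commutator G (commutator G (x c) (x d)) (commutator G (x a) (x b)))"
proof -
  note X = x_lower_central
  let ?v = "commutator G (x a) (x b)"
  have v: "?v \<in> lower_central G 2" by (rule commutators_lower_central(1)[OF abcd(1,2)])
  let ?k = "Lie_class G 4 (commutator G (commutator G (x c) (x d)) ?v)"
  have k: "?k \<in> carrier A"
    using commutator_lower_central[OF _ _ commutators_lower_central(1)[OF abcd(3,4)] v] by simp
  have "Lie_class G 4 (commutator G (commutator G (x d) ?v) (x c)) = cls (a, b, d, c)"
    using Lie_class_commutator_swap_left[OF v X[OF abcd(4)] X[OF abcd(3)]]
      cls_closed[OF abcd(1,2,4,3)] by simp
  then have 1: "cls (a, b, c, d) \<otimes>\<^bsub>A\<^esub> ?k \<otimes>\<^bsub>A\<^esub> cls (a, b, d, c) = \<one>\<^bsub>A\<^esub>"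
    using Lie_class_Jacobi[OF v X[OF abcd(3)] X[OF abcd(4)], of 4] by simp
  have "?k \<otimes>\<^bsub>A\<^esub> (cls (a, b, c, d) \<otimes>\<^bsub>A\<^esub> cls (a, b, d, c)) = \<one>\<^bsub>A\<^esub>"
    using 1 k cls_closed abcd by (simp add: A.m_ac del: cls.simps)
  then have "inv\<^bsub>A\<^esub> (cls (a, b, c, d) \<otimes>\<^bsub>A\<^esub> cls (a, b, d, c)) = ?k"
    using k cls_closed abcd by (intro A.inv_equality) (simp_all del: cls.simps)
  then show ?thesis
    using cls_closed abcd by (simp del: cls.simps)
qed

text \<open>Both sides expand the same bracket: exchanging the entries of [[c, d], [a, b]] inverts
  it, which is invisible in exponent 2.\<close>

lemma cls_four_term:
  assumes abcd: "a < m" "b < m" "c < m" "d < m"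
  shows "cls (a, b, c, d) \<otimes>\<^bsub>A\<^esub> cls (a, b, d, c) = cls (c, d, a, b) \<otimes>\<^bsub>A\<^esub> cls (c, d, b, a)"
proof -
  let ?v = "commutator G (x a) (x b)" and ?w = "commutator G (x c) (x d)"
  have v: "?v \<in> lower_central G 2" "?w \<in> lower_central G 2"
    using abcd by (simp_all only: commutators_lower_central(1))
  have "commutator G ?w ?v \<in> lower_central G 4"
    using commutator_lower_central[OF _ _ v(2,1)] by simp
  then have "Lie_class G 4 (inv (commutator G ?w ?v)) = Lie_class G 4 (commutator G ?w ?v)"
    by (simp add: Lie_class_inv)
  then show ?thesis
    using v by (simp add: cls_Jacobi2 abcd inv_commutator x_closed del: cls.simps)
qed

lemma cls_alternating:
  assumes "a < m" "b < m"
  shows "cls (a, b, a, b) = cls (a, b, b, a)"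
proof -
  have "commutator G (commutator G (x a) (x b)) (commutator G (x a) (x b)) = \<one>"
    using x_closed assms by (simp add: commutator_def m_assoc inv_mult_group)
  then have "cls (a, b, a, b) \<otimes>\<^bsub>A\<^esub> cls (a, b, b, a) = \<one>\<^bsub>A\<^esub>"
    by (simp add: cls_Jacobi2 assms Lie_class_one del: cls.simps)
  then have "inv\<^bsub>A\<^esub> (cls (a, b, b, a)) = cls (a, b, a, b)"
    using cls_closed assms by (intro A.inv_equality) (simp_all del: cls.simps)
  then show ?thesis using cls_closed assms by (simp del: cls.simps)
qed

text \<open>For v = (x a, x b) both (v, x a) and (v, x b) equal v^-2, so each bracket on the left is
  the class of (v^-2, x d). With t = (v^-1, x d) this is t^2 up to weight 5, and t^2 is the inverse
  of (t, x d) because x d is an involution. The square t^2 vanishes in degree 3 but may be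
  non-trivial in degree 4, so the bracket with a square cannot be dropped.\<close>

lemma cls_repeat:
  assumes abd: "a < m" "b < m" "d < m"
  shows "cls (a, b, b, d) = cls (a, b, d, d)" and "cls (a, b, a, d) = cls (a, b, d, d)"
proof -
  note X = x_closed[OF abd(1)] x_closed[OF abd(2)] x_closed[OF abd(3)]
  let ?v = "commutator G (x a) (x b)"
  have v: "?v \<in> lower_central G 2" by (rule commutators_lower_central(1)[OF abd(1,2)])
  then have iv: "inv ?v \<in> lower_central G 2"
    by (simp add: lower_central_subgroup subgroup.m_inv_closed)
  define t where "t = commutator G (inv ?v) (x d)"
  define c where "c = commutator G t (inv ?v)"
  have t: "t \<in> lower_central G 3"
    using commutator_lower_central[OF _ _ iv x_lower_central[OF abd(3)]] by (simp add: t_def)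
  then have tc: "t \<in> carrier G" by simp
  have c: "c \<in> lower_central G 5"
    using commutator_lower_central[OF _ _ t iv] by (simp add: c_def)
  have td: "commutator G t (x d) \<in> lower_central G 4"
    using commutator_lower_central[OF _ _ t x_lower_central[OF abd(3)]] by simp
  have "commutator G t (x d) = inv t \<otimes> inv t"
    unfolding t_def using conj_involution_commutator(1)[OF _ X(3) x_square[OF abd(3)]] X by simp
  then have tt: "t \<otimes> t = inv (commutator G t (x d))"
    using tc by (simp add: inv_mult_group)
  have tt4: "t \<otimes> t \<in> lower_central G 4"
    unfolding tt using td by (simp add: lower_central_subgroup subgroup.m_inv_closed)
  have tct: "t \<otimes> c \<otimes> inv t \<in> lower_central G (Suc 4)"
    using normal.inv_op_closed2[OF lower_central_normal tc c] by simp
  then have tct4: "t \<otimes> c \<otimes> inv t \<in> lower_central G 4"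
    by (rule lower_central_mono) simp
  have "commutator G (inv ?v \<otimes> inv ?v) (x d) = t \<otimes> c \<otimes> t"
    unfolding t_def c_def using X by (simp add: commutator_mult_left)
  also have "\<dots> = (t \<otimes> c \<otimes> inv t) \<otimes> (t \<otimes> t)"
    using tc c by (simp add: m_assoc)
  finally have "Lie_class G 4 (commutator G (inv ?v \<otimes> inv ?v) (x d)) = Lie_class G 4 (t \<otimes> t)"
    using Lie_class_mult[OF tct4 tt4] tct tt4 by (simp del: lower_central.simps)
  also have "\<dots> = Lie_class G 4 (commutator G t (x d))"
    unfolding tt using td by (simp add: Lie_class_inv)
  also have "\<dots> = cls (a, b, d, d)"
    unfolding t_def using Lie_class_commutator2_inv[OF v abd(3,3)] by simp
  finally show "cls (a, b, b, d) = cls (a, b, d, d)" and "cls (a, b, a, d) = cls (a, b, d, d)"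
    using conj_involution_commutator(1)[OF X(1,2) x_square[OF abd(2)]]
      conj_involution_commutator(2)[OF X(2,1) x_square[OF abd(1)]] by simp_all
qed

section \<open>Soundness of the deductions from known brackets\<close>

definition cls_prod :: "quad list \<Rightarrow> 'a set" where
  "cls_prod ws = foldr (\<lambda>w X. cls w \<otimes>\<^bsub>A\<^esub> X) ws \<one>\<^bsub>A\<^esub>"

definition letters_below :: "quad \<Rightarrow> bool" where
  "letters_below w \<longleftrightarrow> (case w of (a, b, c, d) \<Rightarrow> a < m \<and> b < m \<and> c < m \<and> d < m)"

lemma cls_closed' [simp]: "letters_below w \<Longrightarrow> cls w \<in> carrier A"
  using cls_closed by (auto simp: letters_below_def split: prod.splits)

lemma cls_prod_closed: "\<forall>w \<in> set ws. letters_below w \<Longrightarrow> cls_prod ws \<in> carrier A"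
  by (induction ws) (auto simp: cls_prod_def)

lemma cls_prod_relation:
  assumes "r \<in> set (Lie_relations m)"
  shows "cls_prod r = \<one>\<^bsub>A\<^esub>" and "\<forall>w \<in> set r. letters_below w"
proof -
  have sq: "cls w \<otimes>\<^bsub>A\<^esub> cls w = \<one>\<^bsub>A\<^esub>" if "letters_below w" for w
    using that square_A by simp
  have prod4: "X \<otimes>\<^bsub>A\<^esub> (Y \<otimes>\<^bsub>A\<^esub> (Z \<otimes>\<^bsub>A\<^esub> W)) = \<one>\<^bsub>A\<^esub>"
    if "X \<otimes>\<^bsub>A\<^esub> Y = Z \<otimes>\<^bsub>A\<^esub> W" "X \<in> carrier A" "Y \<in> carrier A" "Z \<in> carrier A" "W \<in> carrier A" for X Y Z W
    using that square_A[of "Z \<otimes>\<^bsub>A\<^esub> W"] by (simp flip: A.m_assoc)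
  consider (J) a b c d where "r = [(a, b, c, d), (b, c, a, d), (c, a, b, d)]" "a < m" "b < m" "c < m" "d < m"
    | (K) a b c d where "r = [(a, b, c, d), (a, b, d, c), (c, d, a, b), (c, d, b, a)]" "a < m" "b < m" "c < m" "d < m"
    | (S) a b where "r = [(a, b, a, b), (a, b, b, a)]" "a < m" "b < m"
    | (T1) a b d where "r = [(a, b, a, d), (a, b, d, d)]" "a < m" "b < m" "d < m"
    | (T2) a b d where "r = [(a, b, b, d), (a, b, d, d)]" "a < m" "b < m" "d < m"
    using assms unfolding Lie_relations_def by auto
  then have "cls_prod r = \<one>\<^bsub>A\<^esub> \<and> (\<forall>w \<in> set r. letters_below w)"
  proof cases
    case J
    then show ?thesis using cls_Jacobi3[of a b c d] cls_closed
      by (simp add: cls_prod_def letters_below_def A.m_assoc del: cls.simps)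
  next
    case K
    then show ?thesis using cls_closed
      by (simp add: cls_prod_def letters_below_def prod4 cls_four_term[of a b c d] del: cls.simps)
  next
    case S
    then show ?thesis using cls_closed
      by (simp add: cls_prod_def letters_below_def cls_alternating[of a b] square_A del: cls.simps)
  next
    case T1
    then show ?thesis using cls_closed
      by (simp add: cls_prod_def letters_below_def cls_repeat[of a b d] square_A del: cls.simps)
  next
    case T2
    then show ?thesis using cls_closed
      by (simp add: cls_prod_def letters_below_def cls_repeat[of a b d] square_A del: cls.simps)
  qed
  then show "cls_prod r = \<one>\<^bsub>A\<^esub>" and "\<forall>w \<in> set r. letters_below w" by auto
qed

lemma known_in_subgroup:
  assumes "subgroup T A" "\<forall>w \<in> set S. letters_below w \<and> cls w \<in> T" "letters_below w" "known es S w"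
  shows "cls w \<in> T"
proof -
  obtain a b c d where w: "w = (a, b, c, d)" by (cases w)
  then have abcd: "a < m" "b < m" "c < m" "d < m" using assms by (auto simp: letters_below_def)
  consider "comm_letters es a b" | "(a, b, c, d) \<in> set S" | "(b, a, c, d) \<in> set S"
    using assms(4) by (auto simp: w)
  then show ?thesis
  proof cases
    case 1
    then show ?thesis using cls_comm[OF abcd 1] subgroup.one_closed[OF assms(1)] w by metis
  next
    case 2
    then show ?thesis using assms(2) w by metis
  next
    case 3
    then show ?thesis using assms(2) w cls_swap[OF abcd] by metis
  qed
qed

text \<open>The product over a relation is trivial, so if all factors but one lie in
  \<open>T\<close>, the last one does too. Taking for \<open>T\<close> the subgroup generated by the
  initial brackets shows that deductions never leave it.\<close>

lemma deduce_in_subgroup: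
  assumes T: "subgroup T A" and S: "\<forall>w \<in> set S. letters_below w \<and> cls w \<in> T"
    and r: "r \<in> set (Lie_relations m)"
  shows "\<forall>w \<in> set (deduce es r S). letters_below w \<and> cls w \<in> T"
proof -
  interpret T: subgroup T A by fact
  have split: "Y \<in> T" if "X \<otimes>\<^bsub>A\<^esub> Y \<in> T" "X \<in> T" "Y \<in> carrier A" for X Y
    using T.m_closed[OF T.m_inv_closed[OF that(2)] that(1)] that T.mem_carrier[OF that(2)]
    by (metis A.inv_closed A.l_inv A.l_one A.m_assoc)
  have all: "cls_prod ws \<in> T" if "filter (\<lambda>w. \<not> known es S w) ws = []" "\<forall>w \<in> set ws. letters_below w" for ws
    using that by (induction ws) (auto simp: cls_prod_def known_in_subgroup[OF T S] split: if_splits)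
  have one: "cls w \<in> T"
    if "filter (\<lambda>w. \<not> known es S w) ws = [w]" "\<forall>w \<in> set ws. letters_below w" "cls_prod ws \<in> T" for w ws
    using that
  proof (induction ws)
    case (Cons v ws)
    have cp: "cls_prod (v # ws) = cls v \<otimes>\<^bsub>A\<^esub> cls_prod ws" by (simp add: cls_prod_def)
    have wsc: "cls_prod ws \<in> carrier A" using Cons.prems by (intro cls_prod_closed) auto
    show ?case
    proof (cases "known es S v")
      case True
      then have "cls v \<in> T" using known_in_subgroup[OF T S] Cons.prems by simp
      then have "cls_prod ws \<in> T" using split Cons.prems(3) wsc unfolding cp by blast
      then show ?thesis using Cons True by simp
    next
      case False
      then have v: "v = w" "filter (\<lambda>w. \<not> known es S w) ws = []" using Cons.prems by simp_all
      have "cls_prod ws \<in> T" using all v Cons.prems by simp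
      moreover have "cls v \<in> carrier A" using Cons.prems by simp
      ultimately show ?thesis
        using split Cons.prems(3) wsc v unfolding cp by (metis A.m_comm)
    qed
  qed simp
  show ?thesis
  proof (cases "\<exists>w. filter (\<lambda>w. \<not> known es S w) r = [w]")
    case True
    then obtain w where w: "filter (\<lambda>w. \<not> known es S w) r = [w]" by blast
    then have "w \<in> set (filter (\<lambda>w. \<not> known es S w) r)" by simp
    then have "w \<in> set r" by simp
    then have "letters_below w" "cls w \<in> T"
      using cls_prod_relation[OF r] one[OF w] T.one_closed by auto
    then show ?thesis using S by (simp add: deduce_def w)
  next
    case False
    then have "deduce es r S = S"
      unfolding deduce_def by (auto split: list.splits)
    then show ?thesis using S by simp
  qed
qed

lemma generate_A:
  assumes S: "\<forall>w \<in> set S. letters_below w" and spans: "spans es m n S"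
  shows "generate A (cls ` set S) = carrier A"
proof
  have sub: "cls ` set S \<subseteq> carrier A" using S by (auto simp del: cls.simps)
  let ?T = "generate A (cls ` set S)"
  show "?T \<subseteq> carrier A" using sub by (rule A.generate_incl)
  have T: "subgroup ?T A" using sub by (rule A.generate_is_subgroup)
  have step: "\<forall>w \<in> set (fold (deduce es) rs S'). letters_below w \<and> cls w \<in> ?T"
    if "\<forall>w \<in> set S'. letters_below w \<and> cls w \<in> ?T" "set rs \<subseteq> set (Lie_relations m)" for S' rs
    using that
  proof (induction rs arbitrary: S')
    case (Cons r rs)
    have "\<forall>w \<in> set (deduce es r S'). letters_below w \<and> cls w \<in> ?T"
      by (rule deduce_in_subgroup[OF T Cons.prems(1)]) (use Cons.prems(2) in simp)
    from Cons.IH[OF this] show ?case using Cons.prems(2) by (simp del: cls.simps)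
  qed simp
  define S' where "S' = fold (deduce es) (concat (replicate n (Lie_relations m))) S"
  have S': "\<forall>w \<in> set S'. letters_below w \<and> cls w \<in> ?T"
    unfolding S'_def by (rule step) (use S in \<open>auto intro: generate.incl\<close>)
  have known: "known es S' (a, b, c, d)" if "b < a" "a < m" "c < m" "d < m" for a b c d
    using spans that unfolding spans_def all_known_def S'_def[symmetric]
    by (fastforce simp: list_all_iff simp del: known.simps)
  have "cls (a, b, c, d) \<in> ?T" if "a < m" "b < m" "c < m" "d < m" for a b c d
  proof -
    \<comment> \<open>The check covers b < a; the case a < b is its mirror image, and a = b is known
      since a letter commutes with itself.\<close>
    have "known es S' (a, b, c, d) \<or> known es S' (b, a, c, d)"
      using known[of b a c d] known[of a b c d] that
      by (cases a b rule: linorder_cases) (auto simp: comm_letters_def)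
    then have "known es S' (a, b, c, d)" by (auto simp: comm_letters_def)
    then show ?thesis
      using known_in_subgroup[OF T S'] that by (simp add: letters_below_def del: cls.simps)
  qed
  then show "carrier A \<subseteq> ?T" by (intro carrier_A_subset[OF T])
qed

end

section \<open>Elementary abelian groups with a dual basis\<close>

lemma carrier_Z2: "carrier Z2 = {0, 1}"
  by (auto simp: carrier_integer_mod_group)

lemma Z2_power_simps:
  "carrier (Z2_power n) = (\<Pi>\<^sub>E p\<in>{..<n}. {0, 1})"
  "v \<otimes>\<^bsub>Z2_power n\<^esub> w = (\<lambda>p\<in>{..<n}. (v p + w p) mod 2)"
  by (simp_all add: Z2_power_def product_group_def carrier_Z2)

text \<open>For one or two generators the final conclusion names \<open>Z2\<close> or
  \<open>Z2 \<times>\<times> Z2\<close>; this lemma and the next convert the uniform power into that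
  form.\<close>

lemma Z2_power_1_iso: "Z2_power 1 \<cong> Z2"
proof -
  have "bij_betw (\<lambda>v. v 0) (carrier (Z2_power 1)) (carrier Z2)"
    unfolding Z2_power_simps carrier_Z2
    by (rule bij_betw_byWitness[where f' = "\<lambda>a. \<lambda>p\<in>{..<1}. a"]) (auto simp: PiE_def extensional_def fun_eq_iff)
  moreover have "(\<lambda>v. v 0) \<in> hom (Z2_power 1) Z2"
    by (auto simp: hom_def Z2_power_simps carrier_Z2)
  ultimately show ?thesis unfolding is_iso_def iso_def by blast
qed

lemma Z2_power_2_iso: "Z2_power 2 \<cong> Z2 \<times>\<times> Z2"
proof -
  have "bij_betw (\<lambda>v. (v 0, v 1)) (carrier (Z2_power 2)) (carrier (Z2 \<times>\<times> Z2))"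
    unfolding Z2_power_simps DirProd_def monoid.simps partial_object.simps carrier_Z2
  proof (rule bij_betw_byWitness[where f' = "\<lambda>a. \<lambda>p\<in>{..<2::nat}. if p = 0 then fst a else snd a"])
    show "\<forall>v \<in> {..<2::nat} \<rightarrow>\<^sub>E {0, 1::int}. (\<lambda>p\<in>{..<2::nat}. if p = 0 then fst (v 0, v 1) else snd (v 0, v 1)) = v"
    proof
      fix v :: "nat \<Rightarrow> int" assume v: "v \<in> {..<2} \<rightarrow>\<^sub>E {0, 1}"
      show "(\<lambda>p\<in>{..<2::nat}. if p = 0 then fst (v 0, v 1) else snd (v 0, v 1)) = v"
      proof
        fix p :: nat
        consider "p = 0" | "p = 1" | "p \<notin> {..<2 :: nat}" by fastforce
        then show "(\<lambda>p\<in>{..<2::nat}. if p = 0 then fst (v 0, v 1) else snd (v 0, v 1)) p = v p"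
          by cases (simp_all add: PiE_arb[OF v])
      qed
    qed
    show "(\<lambda>v. (v 0, v 1)) ` ({..<2::nat} \<rightarrow>\<^sub>E {0, 1::int}) \<subseteq> {0, 1} \<times> {0, 1}"
      using PiE_mem by fastforce
    show "(\<lambda>a. \<lambda>p\<in>{..<2::nat}. if p = 0 then fst a else snd a) ` ({0, 1} \<times> {0, 1})
        \<subseteq> {..<2} \<rightarrow>\<^sub>E {0, 1::int}"
      by (intro image_subsetI restrict_PiE_iff[THEN iffD2]) auto
  qed simp
  moreover have "(\<lambda>v. (v 0, v 1)) \<in> hom (Z2_power 2) (Z2 \<times>\<times> Z2)"
  proof (rule homI)
    fix v assume "v \<in> carrier (Z2_power 2)"
    then have v: "v \<in> (\<Pi>\<^sub>E p\<in>{..<2}. {0, 1})" unfolding Z2_power_simps .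
    have "v 0 \<in> {0, 1}" "v 1 \<in> {0, 1}"
      using PiE_mem[OF v, of 0] PiE_mem[OF v, of 1] by simp_all
    then show "(v 0, v 1) \<in> carrier (Z2 \<times>\<times> Z2)"
      by (auto simp: DirProd_def carrier_Z2)
  qed (simp add: Z2_power_simps DirProd_def)
  ultimately show ?thesis unfolding is_iso_def iso_def by blast
qed

text \<open>Generation makes \<open>xs\<close> span G over the field with two elements, and the
  functionals \<open>f p\<close>, dual to \<open>xs\<close>, make it independent: the upper and the
  lower bound meet here.\<close>

locale dual_generators = comm_group +
  fixes xs :: "'a list" and f :: "nat \<Rightarrow> 'a \<Rightarrow> int"
  assumes square: "x \<in> carrier G \<Longrightarrow> x \<otimes> x = \<one>"
    and xs_closed: "set xs \<subseteq> carrier G"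
    and xs_generate: "generate G (set xs) = carrier G"
    and f_mult: "\<lbrakk>p < length xs; x \<in> carrier G; y \<in> carrier G\<rbrakk> \<Longrightarrow> f p (x \<otimes> y) = (f p x + f p y) mod 2"
    and f_dual: "\<lbrakk>p < length xs; q < length xs\<rbrakk> \<Longrightarrow> f p (xs ! q) = (if p = q then 1 else 0)"
begin

lemma f_one: "p < length xs \<Longrightarrow> f p \<one> = 0"
  using f_mult[of p \<one> \<one>] by simp

lemma f_inv: "p < length xs \<Longrightarrow> x \<in> carrier G \<Longrightarrow> f p (inv x) = f p x"
  using square[of x] inv_equality[of x x] by simp

lemma f_range: "p < length xs \<Longrightarrow> x \<in> carrier G \<Longrightarrow> f p x \<in> {0, 1}"
  using f_mult[of p x \<one>] f_one[of p] by auto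

lemma f_finprod:
  assumes "p < length xs" "finite I" "h \<in> I \<rightarrow> carrier G"
  shows "f p (finprod G h I) = (\<Sum>i\<in>I. f p (h i)) mod 2"
  using assms(2,3)
proof (induction I)
  case (insert i I)
  then have "f p (finprod G h (insert i I)) = (f p (h i) + f p (finprod G h I)) mod 2"
    using assms(1) by (simp add: f_mult Pi_def)
  then show ?case using insert by (simp add: mod_add_right_eq)
qed (use assms(1) f_one in simp)

text \<open>The inverse of the coordinate map that sends x to the values \<open>f p x\<close>;
  entries of \<open>v\<close> are meant to be 0 or 1.\<close>

definition combination :: "(nat \<Rightarrow> int) \<Rightarrow> 'a" where
  "combination v = finprod G (\<lambda>p. if v p = 1 then xs ! p else \<one>) {..<length xs}"

lemma nth_closed: "p < length xs \<Longrightarrow> xs ! p \<in> carrier G"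
  using xs_closed nth_mem by blast

lemma combination_closed: "combination v \<in> carrier G"
  unfolding combination_def by (intro finprod_closed) (auto simp: nth_closed)

lemma f_combination:
  assumes q: "q < length xs" and v: "v q \<in> {0, 1}"
  shows "f q (combination v) = v q"
proof -
  have "f q (combination v) = (\<Sum>p<length xs. f q (if v p = 1 then xs ! p else \<one>)) mod 2"
    unfolding combination_def using q by (intro f_finprod) (auto simp: nth_closed)
  also have "(\<Sum>p<length xs. f q (if v p = 1 then xs ! p else \<one>)) = (\<Sum>p<length xs. if p = q then v q else 0)"
    using q v by (intro sum.cong) (auto simp: f_dual f_one)
  also have "\<dots> = v q" using q by simp
  finally show ?thesis using v by auto
qed

text \<open>Recombining the coordinates is a homomorphism that fixes every generator, hence the
  identity.\<close>

lemma combination_f: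
  assumes "x \<in> carrier G"
  shows "combination (\<lambda>p. f p x) = x"
proof -
  have mult: "combination (\<lambda>p. f p (x \<otimes> y)) = combination (\<lambda>p. f p x) \<otimes> combination (\<lambda>p. f p y)"
    if xy: "x \<in> carrier G" "y \<in> carrier G" for x y
    unfolding combination_def
  proof (subst finprod_multf[symmetric])
    show "finprod G (\<lambda>p. if f p (x \<otimes> y) = 1 then xs ! p else \<one>) {..<length xs} =
        finprod G (\<lambda>p. (if f p x = 1 then xs ! p else \<one>) \<otimes> (if f p y = 1 then xs ! p else \<one>)) {..<length xs}"
    proof (rule finprod_cong)
      fix p
      show "p \<in> {..<length xs} =simp=> (if f p (x \<otimes> y) = 1 then xs ! p else \<one>) =
          (if f p x = 1 then xs ! p else \<one>) \<otimes> (if f p y = 1 then xs ! p else \<one>)"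
        unfolding simp_implies_def
      proof -
        assume "p \<in> {..<length xs}"
        then have p: "p < length xs" by simp
        show "(if f p (x \<otimes> y) = 1 then xs ! p else \<one>) =
          (if f p x = 1 then xs ! p else \<one>) \<otimes> (if f p y = 1 then xs ! p else \<one>)"
          using f_range[OF p xy(1)] f_range[OF p xy(2)] nth_closed[OF p] square[OF nth_closed[OF p]]
          by (auto simp: f_mult[OF p xy])
      qed
    qed (auto simp: nth_closed)
  qed (auto simp: nth_closed)
  have gen: "combination (\<lambda>p. f p (xs ! q)) = xs ! q" if "q < length xs" for q
  proof -
    have "combination (\<lambda>p. f p (xs ! q)) = finprod G (\<lambda>p. if q = p then xs ! p else \<one>) {..<length xs}"
      unfolding combination_def using that
      by (intro finprod_cong) (auto simp: f_dual nth_closed simp_implies_def)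
    also have "\<dots> = xs ! q"
      using that nth_closed by (intro finprod_singleton) auto
    finally show ?thesis .
  qed
  have "x \<in> generate G (set xs)" using assms xs_generate by simp
  then show ?thesis
  proof (induction x rule: generate.induct)
    case one
    have "combination (\<lambda>p. f p \<one>) = finprod G (\<lambda>p. \<one>) {..<length xs}"
      unfolding combination_def by (intro finprod_cong) (auto simp: f_one simp_implies_def)
    then show ?case by simp
  next
    case (incl x)
    then show ?case using gen by (auto simp: in_set_conv_nth)
  next
    case (inv x)
    then have "inv x = x" using xs_closed square inv_equality by blast
    then show ?case using gen inv by (auto simp: in_set_conv_nth)
  next
    case (eng x y)
    then show ?case using mult xs_generate by simp
  qed
qed

lemma iso_Z2_power: "G \<cong> Z2_power (length xs)"
proof -
  \<comment> \<open>Restricted, because elements of a product group are \<open>undefined\<close>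
    outside the index set.\<close>
  let ?F = "\<lambda>x. \<lambda>p\<in>{..<length xs}. f p x"
  have c: "combination (?F x) = x" if "x \<in> carrier G" for x
  proof -
    have "combination (?F x) = combination (\<lambda>p. f p x)"
      unfolding combination_def by (intro finprod_cong) (auto simp: nth_closed simp_implies_def)
    then show ?thesis using combination_f[OF that] by simp
  qed
  have "bij_betw ?F (carrier G) (carrier (Z2_power (length xs)))"
    unfolding Z2_power_simps
  proof (rule bij_betw_byWitness[where f' = combination])
    show "\<forall>v \<in> {..<length xs} \<rightarrow>\<^sub>E {0, 1}. ?F (combination v) = v"
    proof
      fix v :: "nat \<Rightarrow> int" assume v: "v \<in> {..<length xs} \<rightarrow>\<^sub>E {0, 1}"
      then have "f q (combination v) = v q" if "q < length xs" for q
        using that by (intro f_combination) auto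
      then show "?F (combination v) = v"
        using v by (intro extensionalityI[of _ "{..<length xs}"]) (auto simp: PiE_def)
    qed
    show "?F ` carrier G \<subseteq> {..<length xs} \<rightarrow>\<^sub>E {0, 1}"
      by (intro image_subsetI restrict_PiE_iff[THEN iffD2]) (use f_range in simp)
  qed (use c combination_closed in auto)
  moreover have "?F \<in> hom G (Z2_power (length xs))"
    using f_range unfolding hom_def Z2_power_simps
    by (auto simp: f_mult fun_eq_iff restrict_PiE_iff simp del: PiE_restrict)
  ultimately show ?thesis unfolding is_iso_def iso_def by blast
qed

text \<open>If T omits \<open>xs ! p\<close>, then \<open>f p\<close> vanishes on T and on all that
  T generates, but it is 1 at \<open>xs ! p\<close>.\<close>

lemma minimally_generated: "minimally_generated_by G xs"
  unfolding minimally_generated_by_def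
proof (intro conjI allI impI)
  show "distinct xs"
    unfolding distinct_conv_nth using f_dual by (metis zero_neq_one)
  fix T assume T: "T \<subset> set xs"
  then obtain p where p: "p < length xs" "xs ! p \<notin> T"
    by (metis in_set_conv_nth psubset_imp_ex_mem DiffD1 DiffD2)
  have "f p x = 0" if "x \<in> generate G T" for x
    using that
  proof (induction x rule: generate.induct)
    case (incl x)
    then obtain q where "q < length xs" "x = xs ! q" using T by (metis in_set_conv_nth psubsetD)
    then show ?case using p incl by (auto simp: f_dual)
  next
    case (inv x)
    then obtain q where q: "q < length xs" "x = xs ! q" using T by (metis in_set_conv_nth psubsetD)
    then show ?case using p inv by (auto simp: f_dual f_inv nth_closed)
  next
    case (eng x y)
    then have "x \<in> carrier G" "y \<in> carrier G"
      using T xs_closed generate_incl[of T] by auto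
    then show ?case using eng p by (simp add: f_mult)
  qed (use p f_one in simp)
  moreover have "f p (xs ! p) = 1" using f_dual p by simp
  ultimately have "xs ! p \<notin> generate G T" by fastforce
  then show "generate G T \<noteq> carrier G" using nth_closed p by auto
qed (use xs_closed xs_generate in auto)

end

section \<open>Representations congruent to the identity modulo 2\<close>

text \<open>The ring may be non-commutative, and congruences are stated by the existence of a
  quotient, never by division, so 2-torsion does no harm.\<close>

locale mod2_representation = group +
  fixes \<Phi> :: "'a \<Rightarrow> 'r :: ring_1"
  assumes \<Phi>_mult: "g \<in> carrier G \<Longrightarrow> h \<in> carrier G \<Longrightarrow> \<Phi> (g \<otimes> h) = \<Phi> g * \<Phi> h"
    and \<Phi>_one: "\<Phi> \<one> = 1"
    and \<Phi>_mod2: "g \<in> carrier G \<Longrightarrow> \<exists>z. \<Phi> g = 1 + 2 * z"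
begin

text \<open>If \<Phi> g = 1 + M a and \<Phi> h = 1 + N b, the products in the two orders differ by M
  N (a b - b a), and the remaining factor \<Phi> (g^-1 h^-1) is 1 modulo 2. Splitting a and b into a
  leading part and twice an error gives the result the shape of the hypotheses, so the lemma
  iterates.\<close>

lemma \<Phi>_commutator:
  assumes g: "g \<in> carrier G" "\<Phi> g = 1 + of_nat m * (z + 2 * z')"
    and h: "h \<in> carrier G" "\<Phi> h = 1 + of_nat n * (w + 2 * w')"
  shows "\<exists>s. \<Phi> (commutator G g h) = 1 + of_nat (m * n) * ((z * w - w * z) + 2 * s)"
proof -
  obtain s where s: "\<Phi> (inv g \<otimes> inv h) = 1 + 2 * s" using \<Phi>_mod2 g(1) h(1) by blast
  define a b where "a = z + 2 * z'" and "b = w + 2 * w'"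
  have swap: "of_nat k * y = y * of_nat k" for k :: nat and y :: 'r
    by (rule mult_of_nat_commute)
  have swap2: "y * 2 = 2 * y" for y :: 'r
    using swap[of 2 y] by simp
  have mn: "of_nat i * u * (of_nat j * v) = of_nat (i * j) * (u * v)" for i j :: nat and u v :: 'r
  proof -
    have "of_nat i * u * (of_nat j * v) = of_nat i * (u * of_nat j) * v" by (simp add: mult.assoc)
    also have "u * of_nat j = of_nat j * u" by (rule swap[symmetric])
    finally show ?thesis by (simp add: mult.assoc)
  qed
  have gh: "\<Phi> g * \<Phi> h = \<Phi> h * \<Phi> g + of_nat (m * n) * (a * b - b * a)"
  proof -
    have "(1 + M) * (1 + N) = (1 + N) * (1 + M) + (M * N - N * M)" for M N :: 'r
      by (simp add: algebra_simps)
    moreover have "of_nat m * a * (of_nat n * b) - of_nat n * b * (of_nat m * a) =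
        of_nat (m * n) * (a * b - b * a)"
      unfolding mn right_diff_distrib by (simp only: mult.commute[of n m])
    ultimately show ?thesis unfolding g(2) h(2) a_def[symmetric] b_def[symmetric] by metis
  qed
  have "commutator G g h = (inv g \<otimes> inv h) \<otimes> (g \<otimes> h)"
    using g(1) h(1) by (simp add: commutator_def m_assoc)
  then have "\<Phi> (commutator G g h) = \<Phi> (inv g \<otimes> inv h) * (\<Phi> g * \<Phi> h)"
    using g(1) h(1) by (simp add: \<Phi>_mult)
  also have "\<dots> = \<Phi> (inv g \<otimes> inv h) * (\<Phi> h * \<Phi> g) + \<Phi> (inv g \<otimes> inv h) * (of_nat (m * n) * (a * b - b * a))"
    unfolding gh by (simp add: distrib_left)
  also have "\<Phi> (inv g \<otimes> inv h) * (\<Phi> h * \<Phi> g) = \<Phi> ((inv g \<otimes> inv h) \<otimes> (h \<otimes> g))"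
    using g(1) h(1) by (simp add: \<Phi>_mult)
  also have "(inv g \<otimes> inv h) \<otimes> (h \<otimes> g) = \<one>"
    using g(1) h(1) by (simp add: m_assoc)
  also have "\<Phi> (inv g \<otimes> inv h) * (of_nat (m * n) * (a * b - b * a)) =
      of_nat (m * n) * ((1 + 2 * s) * (a * b - b * a))"
    unfolding s by (metis mult.assoc swap)
  also have "(1 + 2 * s) * (a * b - b * a) = (z * w - w * z) + 2 *
      (z * w' + z' * w + 2 * (z' * w') - (w * z' + w' * z + 2 * (w' * z')) + s * (a * b - b * a))"
  proof -
    have exp: "(u + 2 * u') * (v + 2 * v') = u * v + 2 * (u * v' + u' * v + 2 * (u' * v'))" for u u' v v' :: 'r
    proof -
      have "u * (2 * v') = 2 * (u * v')" "2 * u' * (2 * v') = 2 * (2 * (u' * v'))"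
        by (metis mult.assoc swap2)+
      then show ?thesis by (simp add: distrib_left distrib_right mult.assoc add.assoc)
    qed
    have "a * b - b * a = (z * w - w * z) + 2 *
      (z * w' + z' * w + 2 * (z' * w') - (w * z' + w' * z + 2 * (w' * z')))"
      unfolding a_def b_def exp by (simp add: algebra_simps)
    then show ?thesis by (simp add: distrib_right mult.assoc distrib_left)
  qed
  finally show ?thesis unfolding \<Phi>_one by blast
qed

text \<open>The elements congruent to 1 modulo a power of 2 form a subgroup, and each commutator
  with an element congruent to 1 modulo 2 gains another factor 2.\<close>

lemma \<Phi>_lower_central: "g \<in> lower_central G (Suc k) \<Longrightarrow> \<exists>z. \<Phi> g = 1 + of_nat (2 ^ Suc k) * z"
proof (induction k arbitrary: g)
  case 0
  then show ?case using \<Phi>_mod2[of g] by simp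
next
  case (Suc k)
  define N :: 'r where "N = of_nat (2 ^ Suc (Suc k))"
  have swap: "N * y = y * N" for y unfolding N_def by (rule mult_of_nat_commute)
  have sub: "subgroup {g \<in> carrier G. \<exists>z. \<Phi> g = 1 + N * z} G"
  proof (rule subgroupI)
    have "\<Phi> \<one> = 1 + N * 0" by (simp add: \<Phi>_one)
    then have "\<one> \<in> {g \<in> carrier G. \<exists>z. \<Phi> g = 1 + N * z}" by blast
    then show "{g \<in> carrier G. \<exists>z. \<Phi> g = 1 + N * z} \<noteq> {}" by fast
  next
    fix g assume "g \<in> {g \<in> carrier G. \<exists>z. \<Phi> g = 1 + N * z}"
    then obtain z where g: "g \<in> carrier G" "\<Phi> g = 1 + N * z" by blast
    have "\<Phi> (inv g) * \<Phi> g = 1"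
      using g(1) by (simp add: \<Phi>_one flip: \<Phi>_mult)
    then have "\<Phi> (inv g) + \<Phi> (inv g) * (N * z) = 1"
      by (simp add: g(2) distrib_left)
    moreover have "\<Phi> (inv g) * (N * z) = N * (\<Phi> (inv g) * z)"
      by (metis mult.assoc swap)
    \<comment> \<open>The quotient is expressed through \<Phi> (g^-1) itself, which avoids a
      geometric series.\<close>
    ultimately have "\<Phi> (inv g) = 1 + N * (- (\<Phi> (inv g) * z))"
      by (simp add: eq_diff_eq)
    then show "inv g \<in> {g \<in> carrier G. \<exists>z. \<Phi> g = 1 + N * z}" using g(1) by blast
  next
    fix g h assume "g \<in> {g \<in> carrier G. \<exists>z. \<Phi> g = 1 + N * z}" "h \<in> {g \<in> carrier G. \<exists>z. \<Phi> g = 1 + N * z}"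
    then obtain z w where g: "g \<in> carrier G" "\<Phi> g = 1 + N * z" and h: "h \<in> carrier G" "\<Phi> h = 1 + N * w"
      by blast
    have "\<Phi> (g \<otimes> h) = 1 + N * (z + w + z * (N * w))"
      using g h by (simp add: \<Phi>_mult algebra_simps)
    then show "g \<otimes> h \<in> {g \<in> carrier G. \<exists>z. \<Phi> g = 1 + N * z}" using g(1) h(1) by blast
  qed auto
  have "{commutator G a b |a b. a \<in> lower_central G (Suc k) \<and> b \<in> carrier G} \<subseteq>
      {g \<in> carrier G. \<exists>z. \<Phi> g = 1 + N * z}"
  proof clarify
    fix a b assume a: "a \<in> lower_central G (Suc k)" and b: "b \<in> carrier G"
    obtain z where z: "\<Phi> a = 1 + of_nat (2 ^ Suc k) * z" using Suc.IH[OF a] by blast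
    obtain w where w: "\<Phi> b = 1 + 2 * w" using \<Phi>_mod2[OF b] by blast
    have "\<exists>s. \<Phi> (commutator G a b) = 1 + of_nat (2 ^ Suc k * 2) * ((z * w - w * z) + 2 * s)"
      by (rule \<Phi>_commutator[where z' = 0 and w' = 0]) (use a b z w in simp_all)
    then show "commutator G a b \<in> carrier G \<and> (\<exists>z. \<Phi> (commutator G a b) = 1 + N * z)"
      using a b unfolding N_def by (auto simp: mult.commute)
  qed
  then have "generate G {commutator G a b |a b. a \<in> lower_central G (Suc k) \<and> b \<in> carrier G} \<subseteq>
      {g \<in> carrier G. \<exists>z. \<Phi> g = 1 + N * z}"
    by (rule generate_subgroup_incl[OF _ sub])
  then show ?case using Suc.prems unfolding N_def lower_central.simps by blast
qed

lemma \<Phi>_commutator4: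
  assumes abcd: "a \<in> carrier G" "b \<in> carrier G" "c \<in> carrier G" "d \<in> carrier G"
    and \<Phi>: "\<Phi> a = 1 + 2 * p" "\<Phi> b = 1 + 2 * q" "\<Phi> c = 1 + 2 * r" "\<Phi> d = 1 + 2 * t"
  defines "br \<equiv> \<lambda>u v :: 'r. u * v - v * u"
  shows "\<exists>s. \<Phi> (commutator G (commutator G (commutator G a b) c) d) =
    1 + of_nat 16 * (br (br (br p q) r) t + 2 * s)"
proof -
  have \<Phi>': "\<Phi> a = 1 + of_nat 2 * (p + 2 * 0)" "\<Phi> b = 1 + of_nat 2 * (q + 2 * 0)"
    "\<Phi> c = 1 + of_nat 2 * (r + 2 * 0)" "\<Phi> d = 1 + of_nat 2 * (t + 2 * 0)"
    using \<Phi> by simp_all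
  obtain s1 where 1: "\<Phi> (commutator G a b) = 1 + of_nat (2 * 2) * (br p q + 2 * s1)"
    using \<Phi>_commutator[OF abcd(1) \<Phi>'(1) abcd(2) \<Phi>'(2)] unfolding br_def by blast
  obtain s2 where 2: "\<Phi> (commutator G (commutator G a b) c) =
      1 + of_nat (2 * 2 * 2) * (br (br p q) r + 2 * s2)"
    using \<Phi>_commutator[OF commutator_closed[OF abcd(1,2)] 1 abcd(3) \<Phi>'(3)] unfolding br_def by blast
  have "\<exists>s. \<Phi> (commutator G (commutator G (commutator G a b) c) d) =
      1 + of_nat (2 * 2 * 2 * 2) * (br (br (br p q) r) t + 2 * s)"
    using \<Phi>_commutator[OF commutator_closed[OF commutator_closed[OF abcd(1,2)] abcd(3)] 2 abcd(4) \<Phi>'(4)]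
    unfolding br_def by blast
  then show ?thesis by simp
qed

text \<open>On \<open>lower_central G 4\<close> and for additive \<psi>, the value \<psi> (\<Phi> g
  - 1) is a multiple of 16, so \<open>div\<close> is exact; a factor from degree 5 changes the
  quotient by an even number.\<close>

definition functional4 :: "('r \<Rightarrow> int) \<Rightarrow> 'a \<Rightarrow> int" where
  "functional4 \<psi> g = \<psi> (\<Phi> g - 1) div 16 mod 2"

lemma functional4_eq:
  assumes "additive \<psi>" "\<Phi> g = 1 + of_nat 16 * (z + 2 * s)"
  shows "functional4 \<psi> g = \<psi> z mod 2"
proof -
  interpret \<psi>: additive \<psi> by fact
  have nat: "\<psi> (of_nat n * y) = int n * \<psi> y" for n y
    by (induction n) (simp_all add: \<psi>.zero \<psi>.add distrib_right)
  have "\<psi> (\<Phi> g - 1) = 16 * (\<psi> z + 2 * \<psi> s)"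
    using assms(2) nat[of 16 "z + 2 * s"] nat[of 2 s] by (simp add: \<psi>.add)
  then show ?thesis by (simp add: functional4_def)
qed

text \<open>The cross term of (1 + 16 z)(1 + 16 w) is 256 z w, which is still even after division by
  16.\<close>

lemma functional4_mult:
  assumes \<psi>: "additive \<psi>" and g: "g \<in> lower_central G 4" and h: "h \<in> lower_central G 4"
  shows "functional4 \<psi> (g \<otimes> h) = (functional4 \<psi> g + functional4 \<psi> h) mod 2"
proof -
  obtain z where z: "\<Phi> g = 1 + of_nat 16 * z" using \<Phi>_lower_central[of g 3] g by auto
  obtain w where w: "\<Phi> h = 1 + of_nat 16 * w" using \<Phi>_lower_central[of h 3] h by auto
  have "\<Phi> (g \<otimes> h) = 1 + of_nat 16 * ((z + w) + 2 * (8 * (z * w)))"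
  proof -
    have "z * (16 * w) = 16 * (z * w)"
      using mult_of_nat_commute[of 16 z] by (simp flip: mult.assoc)
    then show ?thesis using g h z w by (simp add: \<Phi>_mult algebra_simps)
  qed
  then have "functional4 \<psi> (g \<otimes> h) = \<psi> (z + w) mod 2" by (rule functional4_eq[OF \<psi>])
  moreover have "functional4 \<psi> g = \<psi> z mod 2" "functional4 \<psi> h = \<psi> w mod 2"
    using z w by (auto intro!: functional4_eq[OF \<psi>, where s = 0])
  ultimately show ?thesis using \<psi> by (simp add: additive.add mod_add_eq)
qed

lemma functional4_lower_central_5:
  assumes \<psi>: "additive \<psi>" and g: "g \<in> lower_central G 5"
  shows "functional4 \<psi> g = 0"
proof -
  obtain z where z: "\<Phi> g = 1 + of_nat 32 * z" using \<Phi>_lower_central[of g 4] g by auto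
  then have "functional4 \<psi> g = \<psi> 0 mod 2"
    by (intro functional4_eq[OF \<psi>, where s = z]) simp
  then show ?thesis using \<psi> by (simp add: additive.zero)
qed

text \<open>The choice of representative is immaterial for additive \<psi>: two of them differ by an
  element of \<open>lower_central G 5\<close>, where \<open>functional4\<close> vanishes.\<close>

definition Lie_functional4 :: "('r \<Rightarrow> int) \<Rightarrow> 'a set \<Rightarrow> int" where
  "Lie_functional4 \<psi> X = functional4 \<psi> (SOME g. g \<in> lower_central G 4 \<and> X = Lie_class G 4 g)"

lemma Lie_functional4_class:
  assumes \<psi>: "additive \<psi>" and g: "g \<in> lower_central G 4"
  shows "Lie_functional4 \<psi> (Lie_class G 4 g) = functional4 \<psi> g"
proof -
  define h where "h = (SOME h. h \<in> lower_central G 4 \<and> Lie_class G 4 g = Lie_class G 4 h)"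
  have h: "h \<in> lower_central G 4 \<and> Lie_class G 4 g = Lie_class G 4 h"
    unfolding h_def by (rule someI[of _ g]) (use g in simp)
  then have k: "h \<otimes> inv g \<in> lower_central G 5"
    using Lie_class_eq_iff[of h g 4] g lower_central_closed[of h 4] by (simp del: lower_central.simps)
  then have k4: "h \<otimes> inv g \<in> lower_central G 4" by (rule lower_central_mono) simp
  have "h \<in> carrier G" "g \<in> carrier G" using h g lower_central_closed by blast+
  then have "h = h \<otimes> inv g \<otimes> g" by (simp add: m_assoc)
  then have "functional4 \<psi> h = functional4 \<psi> g mod 2"
    using functional4_mult[OF \<psi> k4 g] functional4_lower_central_5[OF \<psi> k] by simp
  also have "\<dots> = functional4 \<psi> g" by (simp add: functional4_def)
  finally show ?thesis by (simp add: Lie_functional4_def h_def)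
qed

lemma Lie_functional4_mult:
  assumes \<psi>: "additive \<psi>" and X: "X \<in> carrier (Lie_component G 4)" and Y: "Y \<in> carrier (Lie_component G 4)"
  shows "Lie_functional4 \<psi> (X \<otimes>\<^bsub>Lie_component G 4\<^esub> Y) = (Lie_functional4 \<psi> X + Lie_functional4 \<psi> Y) mod 2"
proof -
  obtain g h where "g \<in> lower_central G 4" "X = Lie_class G 4 g" "h \<in> lower_central G 4" "Y = Lie_class G 4 h"
    using X Y by (auto simp: Lie_component_carrier)
  then show ?thesis
    using subgroup.m_closed[OF lower_central_subgroup, of g 4 h]
    by (simp add: Lie_functional4_class[OF \<psi>] functional4_mult[OF \<psi>] flip: Lie_class_mult)
qed

end

subsection \<open>A representation by operators on words\<close>

text \<open>The additive endomorphisms of the integer-valued functions on words. They form a type of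
  their own because the target of a \<open>mod2_representation\<close> has to be an instance of
  \<open>ring_1\<close>.\<close>

typedef list_operator =
  "{T :: (nat list \<Rightarrow> int) \<Rightarrow> nat list \<Rightarrow> int. \<forall>u v. T (\<lambda>w. u w + v w) = (\<lambda>w. T u w + T v w)}"
  morphisms apply_operator Abs_list_operator
  by (rule exI[of _ "\<lambda>v. v"]) simp

setup_lifting type_definition_list_operator

instantiation list_operator :: ring_1
begin

lift_definition zero_list_operator :: list_operator is "\<lambda>v w. 0" by simp
lift_definition one_list_operator :: list_operator is "\<lambda>v. v" by simp
lift_definition plus_list_operator :: "list_operator \<Rightarrow> list_operator \<Rightarrow> list_operator"
  is "\<lambda>S T v w. S v w + T v w" by (simp add: fun_eq_iff)
lift_definition uminus_list_operator :: "list_operator \<Rightarrow> list_operator"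
  is "\<lambda>S v w. - S v w" by (simp add: fun_eq_iff)
lift_definition minus_list_operator :: "list_operator \<Rightarrow> list_operator \<Rightarrow> list_operator"
  is "\<lambda>S T v w. S v w - T v w" by (simp add: fun_eq_iff)
lift_definition times_list_operator :: "list_operator \<Rightarrow> list_operator \<Rightarrow> list_operator"
  is "\<lambda>S T v. S (T v)" by simp

instance
proof
  show "(0 :: list_operator) \<noteq> 1"
    by transfer (rule notI, drule fun_cong[of _ _ "\<lambda>_. 1"], drule fun_cong[of _ _ "[]"], simp)
qed (transfer; simp add: fun_eq_iff)+

end

text \<open>A list is read as a word modulo the commutations in \<open>es\<close>; \<open>trim\<close> deletes every \<open>a\<close> that can be moved
  to the front.  These maps are idempotent and commute along edges, so the pullback operators \<open>\<rho>\<^sub>a\<close>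
  satisfy \<open>(2\<rho>\<^sub>a - 1)\<^sup>2 = 1\<close> and represent the Coxeter group.\<close>

fun trim :: "(nat \<times> nat) list \<Rightarrow> nat \<Rightarrow> nat list \<Rightarrow> nat list" where
  "trim es a [] = []"
| "trim es a (b # w) =
     (if a = b then trim es a w else if comm_letters es a b then b # trim es a w else b # w)"

lemma comm_letters_refl [simp]: "comm_letters es a a"
  by (simp add: comm_letters_def)

lemma comm_letters_sym: "comm_letters es a b \<longleftrightarrow> comm_letters es b a"
  by (auto simp: comm_letters_def)

lemma trim_idem: "trim es a (trim es a w) = trim es a w"
  by (induction w) auto

lemma trim_commute: "comm_letters es a b \<Longrightarrow> trim es a (trim es b w) = trim es b (trim es a w)"
  by (induction w) (auto simp: comm_letters_sym[of es b a])

text \<open>Pullback reverses composition: the product of the operators for a and b trims a first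
  and b second. This is why monomials are later evaluated by \<open>fold (trim es)\<close>.\<close>

lift_definition trim_operator :: "(nat \<times> nat) list \<Rightarrow> nat \<Rightarrow> list_operator"
  is "\<lambda>es a v w. v (trim es a w)" by simp

lemma trim_operator_idem: "trim_operator es a * trim_operator es a = trim_operator es a"
  by transfer (simp add: trim_idem)

lemma trim_operator_commute:
  assumes "comm_letters es a b"
  shows "trim_operator es a * trim_operator es b = trim_operator es b * trim_operator es a"
  using assms by transfer (intro ext, metis trim_commute)

definition reflection :: "(nat \<times> nat) list \<Rightarrow> nat \<Rightarrow> list_operator" where
  "reflection es a = 1 + 2 * (trim_operator es a - 1)"

lemma reflection_square: "reflection es a * reflection es a = 1"
proof -
  have "reflection es a = trim_operator es a + trim_operator es a - 1"
    by (simp add: reflection_def right_diff_distrib mult_2)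
  then show ?thesis
    by (simp add: left_diff_distrib right_diff_distrib distrib_left distrib_right trim_operator_idem)
qed

lemma reflection_commute:
  assumes "comm_letters es a b"
  shows "reflection es a * reflection es b = reflection es b * reflection es a"
proof -
  have "reflection es c = trim_operator es c + trim_operator es c - 1" for c
    by (simp add: reflection_def right_diff_distrib mult_2)
  then show ?thesis
    by (simp add: left_diff_distrib right_diff_distrib distrib_left distrib_right
        trim_operator_commute[OF assms])
qed

text \<open>A sum of matrix coefficients, between the indicator of the empty word and the points of
  W. On a product of trimming operators it counts the words in W that are trimmed away
  completely.\<close>

definition empty_coeff :: "nat list list \<Rightarrow> list_operator \<Rightarrow> int" where
  "empty_coeff W T = (\<Sum>w\<leftarrow>W. apply_operator T (\<lambda>w. of_bool (w = [])) w)"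

lemma additive_empty_coeff: "additive (empty_coeff W)"
  by standard (simp add: empty_coeff_def plus_list_operator.rep_eq sum_list_addf)

text \<open>The eight monomials of the bracket, without their signs, which do not matter modulo 2.\<close>

definition bracket_words :: "quad \<Rightarrow> nat list list" where
  "bracket_words = (\<lambda>(a, b, c, d).
     [[a, b, c, d], [b, a, c, d], [c, a, b, d], [c, b, a, d], [d, a, b, c], [d, b, a, c], [d, c, a, b], [d, c, b, a]])"

primrec xor_list :: "bool list \<Rightarrow> bool" where
  "xor_list [] = False"
| "xor_list (b # bs) = (b \<noteq> xor_list bs)"

text \<open>A monomial contributes at w exactly when trimming its letters in turn erases w.
  Exclusive or replaces the integer sum, so the certificate is a purely Boolean evaluation.\<close>

definition bracket_parity :: "(nat \<times> nat) list \<Rightarrow> quad \<Rightarrow> nat list list \<Rightarrow> bool" where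
  "bracket_parity es q W =
     xor_list [xor_list [fold (trim es) u w = []. u \<leftarrow> bracket_words q]. w \<leftarrow> W]"

lemma odd_empty_coeff_bracket:
  fixes es a b c d
  defines "br \<equiv> \<lambda>u v :: list_operator. u * v - v * u" and "T \<equiv> \<lambda>a. trim_operator es a - 1"
  shows "odd (empty_coeff W (br (br (br (T a) (T b)) (T c)) (T d))) \<longleftrightarrow> bracket_parity es (a, b, c, d) W"
proof -
  \<comment> \<open>The identity operator is central and drops out of every commutator, which leaves
    eight signed products of trimming operators.\<close>
  have br: "br u (T c) = br u (trim_operator es c)" "br (T c) u = br (trim_operator es c) u" for u c
    by (simp_all add: br_def T_def algebra_simps)
  have one: "even (apply_operator (br (br (br (T a) (T b)) (T c)) (T d)) (\<lambda>w. of_bool (w = [])) w) \<longleftrightarrow>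
      \<not> xor_list [fold (trim es) u w = []. u \<leftarrow> bracket_words (a, b, c, d)]" for w
    unfolding br unfolding br_def
    by (simp add: minus_list_operator.rep_eq times_list_operator.rep_eq trim_operator.rep_eq
        plus_list_operator.rep_eq algebra_simps bracket_words_def)
  show ?thesis
    by (induction W) (auto simp: empty_coeff_def bracket_parity_def one)
qed

section \<open>Right-angled Coxeter groups\<close>

text \<open>The sign of a letter is ignored, since the values of \<open>h\<close> will be
  involutions and thus their own inverses.\<close>

definition eval_word :: "('a \<Rightarrow> 'b :: monoid_mult) \<Rightarrow> 'a word \<Rightarrow> 'b" where
  "eval_word h u = prod_list (map (h \<circ> fst) u)"

lemma eval_word_simps [simp]:
  "eval_word h [] = 1" "eval_word h (p # u) = h (fst p) * eval_word h u"
  "eval_word h (u @ v) = eval_word h u * eval_word h v"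
  by (simp_all add: eval_word_def)

lemma eval_word_pres_eq:
  assumes "pres_eq S R u v"
    and "\<And>x. x \<in> S \<Longrightarrow> h x * h x = 1"
    and "\<And>r s. (r, s) \<in> R \<Longrightarrow> eval_word h r = eval_word h s"
  shows "eval_word h u = eval_word h v"
  using assms(1)
proof (induction rule: pres_eq.induct)
  case (cancel u v x b)
  have "h x * (h x * eval_word h v) = eval_word h v"
    using assms(2)[OF cancel(3)] by (simp flip: mult.assoc)
  then show ?case by simp
qed (simp_all add: assms(3))

definition eval_class :: "('a \<Rightarrow> 'b :: monoid_mult) \<Rightarrow> 'a word set \<Rightarrow> 'b" where
  "eval_class h X = eval_word h (SOME u. u \<in> X)"

text \<open>The universal property of the presentation, for maps that send generators to involutions
  and respect the relations: every representative gives the same value.\<close>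

lemma eval_class:
  assumes u: "u \<in> words S" and h: "\<And>x. x \<in> S \<Longrightarrow> h x * h x = 1"
    and R: "\<And>r s. (r, s) \<in> R \<Longrightarrow> eval_word h r = eval_word h s"
  shows "eval_class h (pres_rel S R `` {u}) = eval_word h u"
proof -
  have "u \<in> pres_rel S R `` {u}" using u by (simp add: pres_rel_def pres_eq.refl)
  then have "(SOME v. v \<in> pres_rel S R `` {u}) \<in> pres_rel S R `` {u}" by (rule someI)
  then have "pres_eq S R u (SOME v. v \<in> pres_rel S R `` {u})"
    by (simp add: pres_rel_def)
  from eval_word_pres_eq[OF this h R] show ?thesis by (simp add: eval_class_def)
qed

section \<open>Generators, relations and brackets in the Coxeter group\<close>

lemma generate_pres_gen: "generate (presented_group S R) (pres_gen S R ` S) = carrier (presented_group S R)"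
proof -
  interpret group "presented_group S R" by (rule presented_group_is_group)
  have gen: "pres_gen S R x \<in> carrier (presented_group S R)" if "x \<in> S" for x
    unfolding pres_gen_def using that by (intro presented_carrierI) simp
  have "pres_rel S R `` {u} \<in> generate (presented_group S R) (pres_gen S R ` S)" if "u \<in> words S" for u
    using that
  proof (induction u)
    case Nil
    show ?case using generate.one[of "presented_group S R"] by (simp add: presented_one)
  next
    case (Cons p u)
    obtain x b where p: "p = (x, b)" by fastforce
    have x: "x \<in> S" and u: "u \<in> words S" using Cons.prems by (simp_all add: p)
    have "pres_rel S R `` {[(x, b)]} \<in> generate (presented_group S R) (pres_gen S R ` S)"
    proof (cases b)
      case True
      then show ?thesis using x by (auto simp: pres_gen_def intro: generate.incl)
    next
      case False
      have "pres_eq S R ([] @ [(x, False), (x, \<not> False)] @ []) ([] @ [])"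
        using x by (intro pres_eq.cancel) auto
      then have "pres_rel S R `` {[(x, False)] @ [(x, True)]} = pres_rel S R `` {[]}"
        using x by (subst pres_class_eq_iff) auto
      then have "pres_rel S R `` {[(x, False)]} \<otimes>\<^bsub>presented_group S R\<^esub> pres_gen S R x =
          \<one>\<^bsub>presented_group S R\<^esub>"
        unfolding pres_gen_def presented_one using x by (subst presented_mult) auto
      then have "inv\<^bsub>presented_group S R\<^esub> pres_gen S R x = pres_rel S R `` {[(x, False)]}"
        using x gen by (intro inv_equality presented_carrierI) auto
      then show ?thesis using generate.inv[of "pres_gen S R x"] x False by (metis imageI)
    qed
    moreover have "pres_rel S R `` {[(x, b)] @ u} =
        pres_rel S R `` {[(x, b)]} \<otimes>\<^bsub>presented_group S R\<^esub> pres_rel S R `` {u}"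
      by (rule presented_mult[symmetric]) (use x u in auto)
    ultimately show ?case
      using Cons.IH[OF u] generate.eng by (simp add: p)
  qed
  then have "carrier (presented_group S R) \<subseteq> generate (presented_group S R) (pres_gen S R ` S)"
    by (metis presented_carrierE subsetI)
  moreover have "generate (presented_group S R) (pres_gen S R ` S) \<subseteq> carrier (presented_group S R)"
    using gen by (intro generate_incl) auto
  ultimately show ?thesis by (rule equalityI[rotated])
qed

lemma RC_gen_closed: "i \<in> {1..m} \<Longrightarrow> RC_gen m K i \<in> carrier (RC m K)"
  unfolding RC_gen_def RC_def pres_gen_def by (intro presented_carrierI) simp

lemma RC_class_eq:
  assumes "(r, s) \<in> RC_relations m K" "r \<in> words {1..m}" "s \<in> words {1..m}"
  shows "pres_rel {1..m} (RC_relations m K) `` {r} = pres_rel {1..m} (RC_relations m K) `` {s}"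
  using pres_eq.rel[OF assms, of "[]" "[]"] assms by (subst pres_class_eq_iff) auto

lemma RC_gen_square:
  assumes "i \<in> {1..m}"
  shows "RC_gen m K i \<otimes>\<^bsub>RC m K\<^esub> RC_gen m K i = \<one>\<^bsub>RC m K\<^esub>"
proof -
  have "pres_rel {1..m} (RC_relations m K) `` {[(i, True)] @ [(i, True)]} =
      pres_rel {1..m} (RC_relations m K) `` {[]}"
    by (rule RC_class_eq) (use assms in \<open>auto simp: RC_relations_def\<close>)
  then show ?thesis
    unfolding RC_gen_def RC_def pres_gen_def presented_one using assms by (subst presented_mult) auto
qed

lemma RC_gen_commute:
  assumes "i \<in> {1..m}" "j \<in> {1..m}" "{i, j} \<in> K"
  shows "RC_gen m K i \<otimes>\<^bsub>RC m K\<^esub> RC_gen m K j = RC_gen m K j \<otimes>\<^bsub>RC m K\<^esub> RC_gen m K i"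
proof -
  have "pres_rel {1..m} (RC_relations m K) `` {[(i, True)] @ [(j, True)]} =
      pres_rel {1..m} (RC_relations m K) `` {[(j, True)] @ [(i, True)]}"
    by (rule RC_class_eq) (use assms in \<open>auto simp: RC_relations_def\<close>)
  then show ?thesis
    unfolding RC_gen_def RC_def pres_gen_def using assms by (simp add: presented_mult del: append.simps)
qed

text \<open>Collapses the nested unions of \<open>Lie_bracket\<close> to the class of one iterated
  group commutator, the form in which both bounds are proved.\<close>

lemma \<mu>_bracket4_eq:
  assumes "a \<in> {1..m}" "b \<in> {1..m}" "c \<in> {1..m}" "d \<in> {1..m}"
  shows "\<mu>_bracket4 m K a b c d = Lie_class (RC m K) 4 (commutator (RC m K) (commutator (RC m K)
    (commutator (RC m K) (RC_gen m K a) (RC_gen m K b)) (RC_gen m K c)) (RC_gen m K d))"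
proof -
  interpret group "RC m K" by (rule RC_group)
  have g: "RC_gen m K i \<in> lower_central (RC m K) 1" if "i \<in> {1..m}" for i
    using that RC_gen_closed by simp
  have 2: "commutator (RC m K) (RC_gen m K a) (RC_gen m K b) \<in> lower_central (RC m K) 2"
    using commutator_lower_central[OF _ _ g[OF assms(1)] g[OF assms(2)]]
    by (simp add: numeral_2_eq_2 del: lower_central.simps)
  have 3: "commutator (RC m K) (commutator (RC m K) (RC_gen m K a) (RC_gen m K b)) (RC_gen m K c)
      \<in> lower_central (RC m K) 3"
    using commutator_lower_central[OF _ _ 2 g[OF assms(3)]] by simp
  show ?thesis
    unfolding \<mu>_bracket4_def \<mu>_def
    using Lie_bracket_Lie_class[OF _ _ g[OF assms(1)] g[OF assms(2)], unfolded one_add_one]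
      Lie_bracket_Lie_class[OF _ _ 2 g[OF assms(3)]]
      Lie_bracket_Lie_class[OF _ _ 3 g[OF assms(4)]]
    by (simp add: one_add_one del: lower_central.simps)
qed

text \<open>The word sets in \<open>Ws\<close> define functionals modulo 2 that are dual to the brackets in \<open>qs\<close>.\<close>

definition dual_words :: "(nat \<times> nat) list \<Rightarrow> quad list \<Rightarrow> nat list list list \<Rightarrow> bool" where
  "dual_words es qs Ws \<longleftrightarrow>
     map (\<lambda>W. map (\<lambda>q. bracket_parity es q W) qs) Ws =
     map (\<lambda>i. map (\<lambda>j. i = j) [0..<length qs]) [0..<length qs]"

definition below :: "nat \<Rightarrow> quad list \<Rightarrow> bool" where
  "below m = list_all (\<lambda>(a, b, c, d). a < m \<and> b < m \<and> c < m \<and> d < m)"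

text \<open>Gathers all that is settled by evaluation. It depends on the graph with standard labels,
  not on the complex or on the names of its vertices.\<close>

definition basis_certificate ::
    "(nat \<times> nat) list \<Rightarrow> nat \<Rightarrow> nat \<Rightarrow> quad list \<Rightarrow> nat list list list \<Rightarrow> bool" where
  "basis_certificate es m n qs Ws \<longleftrightarrow> below m qs \<and> spans es m n qs \<and> dual_words es qs Ws"

text \<open>The edge hypothesis works in both directions. A pair listed in \<open>es\<close> is an
  edge of K and gives a commutation in the group, as the upper bound requires; an edge of K is
  listed in \<open>es\<close>, so the reflections satisfy the defining relations, as the lower bound
  requires.\<close>

theorem RC_Lie_component_4:
  assumes \<sigma>: "bij_betw \<sigma> {..<m} {1..m}"
    and es: "\<And>a b. a < m \<Longrightarrow> b < m \<Longrightarrow> a \<noteq> b \<Longrightarrow> {\<sigma> a, \<sigma> b} \<in> K \<longleftrightarrow> comm_letters es a b"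
    and basis: "basis_certificate es m n qs Ws"
  shows "Lie_component (RC m K) 4 \<cong> Z2_power (length qs) \<and>
    minimally_generated_by (Lie_component (RC m K) 4)
      (map (\<lambda>(a, b, c, d). \<mu>_bracket4 m K (\<sigma> a) (\<sigma> b) (\<sigma> c) (\<sigma> d)) qs)"
proof -
  let ?G = "RC m K"
  have qs: "below m qs" and spans: "spans es m n qs" and dual: "dual_words es qs Ws"
    using basis by (simp_all add: basis_certificate_def)
  define \<tau> where "\<tau> = inv_into {..<m} \<sigma>"
  have \<sigma>_in: "\<sigma> a \<in> {1..m}" if "a < m" for a using \<sigma> that bij_betwE by blast
  have \<tau>_in: "\<tau> v < m" if "v \<in> {1..m}" for v
    using bij_betwE[OF bij_betw_inv_into[OF \<sigma>]] that by (auto simp: \<tau>_def)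
  have \<tau>\<sigma>: "\<tau> (\<sigma> a) = a" if "a < m" for a
    using bij_betw_inv_into_left[OF \<sigma>] that by (simp add: \<tau>_def)
  have \<sigma>\<tau>: "\<sigma> (\<tau> v) = v" if "v \<in> {1..m}" for v
    using bij_betw_inv_into_right[OF \<sigma>] that by (simp add: \<tau>_def)
  \<comment> \<open>Generators act by reflections, after translating vertices back to letters, the
    alphabet on which \<open>trim\<close> works.\<close>
  define h where "h = (\<lambda>v. reflection es (\<tau> v))"
  have h_square: "h v * h v = 1" for v by (simp add: h_def reflection_square)
  have h_rel: "eval_word h r = eval_word h s" if rs: "(r, s) \<in> RC_relations m K" for r s
  proof -
    have commute: "h i * h j = h j * h i" if "i \<in> {1..m}" "j \<in> {1..m}" "{i, j} \<in> K" for i j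
    proof (cases "i = j")
      case False
      then have "\<tau> i \<noteq> \<tau> j" using \<sigma>\<tau> that by metis
      then have "comm_letters es (\<tau> i) (\<tau> j)"
        using es[of "\<tau> i" "\<tau> j"] \<tau>_in \<sigma>\<tau> that by simp
      then show ?thesis unfolding h_def by (rule reflection_commute)
    qed simp
    show ?thesis using rs by (auto simp: RC_relations_def h_square intro!: commute)
  qed
  have eval: "eval_class h (pres_rel {1..m} (RC_relations m K) `` {u}) = eval_word h u"
    if "u \<in> words {1..m}" for u
    using that h_square h_rel by (rule eval_class)
  interpret G: involution_generated ?G "\<lambda>a. RC_gen m K (\<sigma> a)" m es
  proof (intro involution_generated.intro RC_group involution_generated_axioms.intro)
    have "(\<lambda>a. RC_gen m K (\<sigma> a)) ` {..<m} = RC_gen m K ` {1..m}"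
      using bij_betw_imp_surj_on[OF \<sigma>] by (metis image_image)
    then show "generate ?G ((\<lambda>a. RC_gen m K (\<sigma> a)) ` {..<m}) = carrier ?G"
      using generate_pres_gen[of "{1..m}" "RC_relations m K"]
      by (simp add: RC_def RC_gen_def[abs_def])
  next
    fix a b assume "a < m" "b < m" "comm_letters es a b"
    then show "RC_gen m K (\<sigma> a) \<otimes>\<^bsub>?G\<^esub> RC_gen m K (\<sigma> b) = RC_gen m K (\<sigma> b) \<otimes>\<^bsub>?G\<^esub> RC_gen m K (\<sigma> a)"
      using es[of a b] RC_gen_commute[of "\<sigma> a" m "\<sigma> b" K] \<sigma>_in by (cases "a = b") simp_all
  qed (use \<sigma>_in RC_gen_closed RC_gen_square in auto)
  interpret G: mod2_representation ?G "eval_class h"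
  proof (intro mod2_representation.intro RC_group mod2_representation_axioms.intro)
    fix X Y assume "X \<in> carrier ?G" "Y \<in> carrier ?G"
    then obtain u v where "u \<in> words {1..m}" "X = pres_rel {1..m} (RC_relations m K) `` {u}"
      "v \<in> words {1..m}" "Y = pres_rel {1..m} (RC_relations m K) `` {v}"
      unfolding RC_def by (elim presented_carrierE)
    then show "eval_class h (X \<otimes>\<^bsub>?G\<^esub> Y) = eval_class h X * eval_class h Y"
      by (simp only: RC_def presented_mult eval words_append eval_word_simps)
  next
    show "eval_class h \<one>\<^bsub>?G\<^esub> = 1" by (simp only: RC_def presented_one eval words_Nil eval_word_simps)
  next
    fix X assume "X \<in> carrier ?G"
    then obtain u where u: "u \<in> words {1..m}" "X = pres_rel {1..m} (RC_relations m K) `` {u}"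
      unfolding RC_def by (elim presented_carrierE)
    have "\<exists>z. eval_word h u = 1 + 2 * z"
    proof (induction u)
      case Nil
      have "eval_word h [] = 1 + 2 * 0" by simp
      then show ?case by blast
    next
      case (Cons p u)
      then obtain z where z: "eval_word h u = 1 + 2 * z" by blast
      obtain y where y: "h (fst p) = 1 + 2 * y" unfolding h_def reflection_def by blast
      have "eval_word h (p # u) = 1 + 2 * (y + z + y * (2 * z))"
        by (simp add: y z distrib_left distrib_right mult.assoc add.assoc)
      then show ?case by blast
    qed
    then show "\<exists>z. eval_class h X = 1 + 2 * z" unfolding u(2) eval[OF u(1)] .
  qed
  have \<Phi>_gen: "eval_class h (RC_gen m K (\<sigma> a)) = 1 + 2 * (trim_operator es a - 1)" if "a < m" for a
    using that \<sigma>_in eval[of "[(\<sigma> a, True)]"]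
    by (simp add: RC_gen_def pres_gen_def h_def \<tau>\<sigma> reflection_def)
  \<comment> \<open>Links the group to the certificate: each functional takes a computable parity as
    its value on each bracket.\<close>
  have functional: "G.Lie_functional4 (empty_coeff W) (G.cls q) = of_bool (bracket_parity es q W)"
    if q: "G.letters_below q" for q W
  proof -
    obtain a b c d where q': "q = (a, b, c, d)" by (cases q)
    then have abcd: "a < m" "b < m" "c < m" "d < m" using q by (simp_all add: G.letters_below_def)
    note closed = G.x_closed[OF abcd(1)] G.x_closed[OF abcd(2)] G.x_closed[OF abcd(3)] G.x_closed[OF abcd(4)]
    obtain s where s: "eval_class h (commutator ?G (commutator ?G (commutator ?G (RC_gen m K (\<sigma> a)) (RC_gen m K (\<sigma> b)))
        (RC_gen m K (\<sigma> c))) (RC_gen m K (\<sigma> d))) = 1 + of_nat 16 * (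
        (\<lambda>u v. u * v - v * u) ((\<lambda>u v. u * v - v * u) ((\<lambda>u v. u * v - v * u)
          (trim_operator es a - 1) (trim_operator es b - 1)) (trim_operator es c - 1)) (trim_operator es d - 1) + 2 * s)"
      using G.\<Phi>_commutator4[OF closed \<Phi>_gen[OF abcd(1)] \<Phi>_gen[OF abcd(2)] \<Phi>_gen[OF abcd(3)] \<Phi>_gen[OF abcd(4)]]
      by blast
    show ?thesis
      unfolding q' G.cls.simps
        G.Lie_functional4_class[OF additive_empty_coeff G.commutators_lower_central(3)[OF abcd]]
        G.functional4_eq[OF additive_empty_coeff s]
      using odd_empty_coeff_bracket[of W es a b c d] by (auto simp: mod2_eq_if)
  qed
  have below: "\<forall>q \<in> set qs. G.letters_below q"
    using qs by (auto simp: below_def list_all_iff G.letters_below_def)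
  have lenWs: "length Ws = length qs"
    using arg_cong[OF dual[unfolded dual_words_def], of length] by simp
  have parity: "bracket_parity es (qs ! j) (Ws ! i) \<longleftrightarrow> i = j" if "i < length qs" "j < length qs" for i j
    using arg_cong[OF dual[unfolded dual_words_def], of "\<lambda>M. M ! i ! j"] that lenWs by simp
  interpret dual_generators G.A "map G.cls qs" "\<lambda>p. G.Lie_functional4 (empty_coeff (Ws ! p))"
  proof (intro dual_generators.intro G.A.comm_group_axioms dual_generators_axioms.intro)
    show "generate G.A (set (map G.cls qs)) = carrier G.A"
      using G.generate_A[OF below spans] by simp
    show "set (map G.cls qs) \<subseteq> carrier G.A" using below by (auto simp del: G.cls.simps)
  qed (use below in \<open>simp_all add: G.square_A G.Lie_functional4_mult[OF additive_empty_coeff] functional parity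
        del: G.cls.simps\<close>)
  have eq: "map (\<lambda>(a, b, c, d). \<mu>_bracket4 m K (\<sigma> a) (\<sigma> b) (\<sigma> c) (\<sigma> d)) qs = map G.cls qs"
    using below \<sigma>_in by (auto simp: G.letters_below_def \<mu>_bracket4_eq)
  show ?thesis using iso_Z2_power minimally_generated unfolding eq by simp
qed

section \<open>The graphs on four vertices\<close>

text \<open>In all certificates the letters 0, 1, 2, 3 stand for i, j, k, l, and the pairs are the
  edges present, also where the theorem lists the missing ones.\<close>

lemma basis_complete:
  "basis_certificate [(0, 1), (0, 2), (0, 3), (1, 2), (1, 3), (2, 3)] 4 1
      []
      []"
  by code_simp

lemma basis_diamond:
  "basis_certificate [(0, 2), (0, 3), (1, 2), (1, 3), (2, 3)] 4 2
      [(1, 0, 0, 0)]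
      [[[0, 1]]]"
  by code_simp

lemma basis_square:
  "basis_certificate [(0, 1), (0, 3), (1, 2), (2, 3)] 4 2
      [(0, 2, 2, 2), (1, 3, 3, 3)]
      [[[0, 2]], [[1, 3]]]"
  by code_simp

lemma basis_paw:
  "basis_certificate [(0, 1), (0, 3), (1, 2), (1, 3)] 4 2
      [(2, 0, 0, 0), (3, 2, 2, 2), (2, 3, 2, 0), (2, 3, 0, 2)]
      [[[0, 2]], [[2, 3]], [[0, 2, 3]], [[0, 2, 3, 2]]]"
  by code_simp

text \<open>The coefficient at the word 1, 0, 2 alone is odd on both (2, 0, 0, 1) and (2, 0, 1, 2).
  Adding the test word of the last functional cancels the second value, hence the one entry with two
  words.\<close>

lemma basis_star:
  "basis_certificate [(0, 3), (1, 3), (2, 3)] 4 2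
      [(1, 0, 0, 0), (2, 0, 0, 0), (2, 1, 1, 0), (2, 0, 1, 0), (2, 0, 0, 1), (2, 1, 1, 1),
       (2, 1, 0, 1), (2, 0, 1, 2)]
      [[[0, 1]], [[0, 2]], [[0, 1, 2]], [[0, 1, 0, 2]], [[1, 0, 2], [0, 2, 1, 2]], [[1, 2]],
       [[0, 1, 2, 1]], [[0, 2, 1, 2]]]"
  by code_simp

lemma basis_triangle:
  "basis_certificate [(1, 2), (1, 3), (2, 3)] 4 2
      [(0, 2, 0, 1), (0, 2, 1, 0), (0, 1, 1, 1), (0, 3, 0, 1), (0, 3, 1, 0), (0, 2, 2, 2),
       (3, 0, 0, 0), (0, 3, 0, 2), (0, 3, 2, 0), (0, 3, 1, 2)]
      [[[1, 0, 2]], [[0, 1, 0, 2]], [[0, 1]], [[1, 0, 3]], [[0, 1, 0, 3]], [[0, 2]], [[0, 3]],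
       [[2, 0, 3]], [[0, 2, 0, 3]], [[0, 1, 2, 3]]]"
  by code_simp

lemma basis_path:
  "basis_certificate [(0, 1), (1, 2), (2, 3)] 4 2
      [(2, 0, 2, 2), (0, 3, 0, 2), (0, 3, 2, 0), (0, 3, 0, 0), (3, 1, 3, 3), (3, 1, 3, 0),
       (3, 1, 0, 3), (3, 1, 0, 2)]
      [[[0, 2]], [[2, 0, 3]], [[0, 2, 0, 3]], [[0, 3]], [[1, 3]], [[0, 3, 1]], [[0, 3, 1, 3]],
       [[0, 1, 2, 3]]]"
  by code_simp

text \<open>The third entry has two words because the coefficient at 2, 1, 3 is odd on (3, 1, 1, 2)
  and on (3, 1, 2, 3); the test word of the fifth entry corrects this.\<close>

lemma basis_two_adjacent_edges:
  "basis_certificate [(0, 1), (0, 3)] 4 2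
      [(3, 2, 2, 1), (3, 1, 2, 1), (3, 1, 1, 2), (3, 2, 1, 2), (3, 1, 2, 3), (0, 2, 2, 1),
       (0, 2, 1, 2), (2, 1, 1, 1), (3, 1, 1, 1), (3, 2, 3, 3), (2, 0, 2, 2), (2, 0, 2, 3),
       (2, 0, 3, 2), (2, 0, 3, 1), (2, 0, 1, 3)]
      [[[1, 2, 3]], [[1, 2, 1, 3]], [[2, 1, 3], [1, 3, 2, 3]], [[1, 2, 3, 2]], [[1, 3, 2, 3]],
       [[0, 2, 1]], [[0, 2, 1, 2]], [[1, 2]], [[1, 3]], [[2, 3]], [[0, 2]], [[0, 2, 3]],
       [[0, 2, 3, 2]], [[0, 1, 3, 2]], [[0, 2, 1, 3]]]"
  by code_simp

lemma basis_two_disjoint_edges: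
  "basis_certificate [(0, 1), (2, 3)] 4 2
      [(2, 1, 2, 0), (2, 1, 0, 2), (2, 0, 2, 2), (0, 3, 0, 2), (0, 3, 2, 0), (0, 3, 0, 0),
       (3, 1, 3, 0), (3, 1, 0, 3), (2, 1, 2, 2), (1, 3, 1, 1), (1, 3, 1, 2), (1, 3, 2, 1),
       (0, 3, 2, 1), (1, 3, 0, 2), (1, 3, 2, 0)]
      [[[0, 2, 1]], [[0, 2, 1, 2]], [[0, 2]], [[2, 0, 3]], [[0, 2, 0, 3]], [[0, 3]],
       [[0, 3, 1]], [[0, 3, 1, 3]], [[1, 2]], [[1, 3]], [[2, 1, 3]], [[1, 2, 1, 3]],
       [[1, 2, 0, 3]], [[2, 0, 1, 3]], [[0, 2, 1, 3]]]"
  by code_simp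

text \<open>The two entries with two words are exchanged by swapping 0 and 1, the ends of the edge.
  In each, the second word removes an odd value on (0, 2, 3, 0) or (1, 2, 3, 1).\<close>

lemma basis_one_edge:
  "basis_certificate [(0, 1)] 4 3
      [(0, 3, 3, 2), (0, 2, 3, 2), (0, 2, 2, 3), (0, 3, 2, 3), (0, 2, 3, 0), (3, 2, 2, 2),
       (1, 3, 3, 2), (1, 2, 3, 2), (1, 2, 2, 3), (1, 3, 2, 3), (1, 2, 3, 1), (0, 2, 0, 0),
       (2, 1, 2, 2), (2, 1, 2, 0), (2, 1, 0, 2), (0, 3, 0, 0), (3, 1, 3, 3), (3, 1, 3, 0),
       (3, 1, 0, 3), (3, 1, 0, 2), (2, 1, 0, 3), (2, 1, 3, 0), (3, 1, 2, 0)]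
      [[[0, 3, 2]], [[0, 2, 3, 2]], [[0, 2, 3], [0, 2, 0, 3]], [[0, 3, 2, 3]], [[0, 2, 0, 3]],
       [[2, 3]], [[1, 3, 2]], [[1, 2, 3, 2]], [[1, 2, 3], [1, 2, 1, 3]], [[1, 3, 2, 3]],
       [[1, 2, 1, 3]], [[0, 2]], [[1, 2]], [[0, 2, 1]], [[0, 2, 1, 2]], [[0, 3]], [[1, 3]],
       [[0, 3, 1]], [[0, 3, 1, 3]], [[1, 3, 0, 2]], [[1, 2, 0, 3]], [[0, 3, 2, 1]],
       [[0, 2, 3, 1]]]"
  by code_simp

section \<open>Transfer from standard letters to the vertices i, j, k, l\<close>

lemma letters_bij:
  assumes "distinct [i, j, k, l]" "{i, j, k, l} = {1..4 :: nat}"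
  shows "bij_betw (\<lambda>a. [i, j, k, l] ! a) {..<4} {1..4}"
proof -
  have "bij_betw (\<lambda>a. [i, j, k, l] ! a) {..<length [i, j, k, l]} (set [i, j, k, l])"
    by (rule bij_betw_nth[OF assms(1)]) simp_all
  then show ?thesis using assms(2) by (simp add: numeral_eq_Suc)
qed

text \<open>The six edge conditions are spelled out so that rewriting decides them in each case, and
  \<open>N\<close> is separate from \<open>length qs\<close> so that the exponent appears as a
  numeral.\<close>

lemma RC_4_Lie_component_4:
  assumes "distinct [i, j, k, l]" "{i, j, k, l} = {1..4}"
    and edges: "{i, j} \<in> K \<longleftrightarrow> comm_letters es 0 1" "{i, k} \<in> K \<longleftrightarrow> comm_letters es 0 2"
      "{i, l} \<in> K \<longleftrightarrow> comm_letters es 0 3" "{j, k} \<in> K \<longleftrightarrow> comm_letters es 1 2"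
      "{j, l} \<in> K \<longleftrightarrow> comm_letters es 1 3" "{k, l} \<in> K \<longleftrightarrow> comm_letters es 2 3"
    and basis: "basis_certificate es 4 n qs Ws" and N: "length qs = N"
  shows "Lie_component (RC 4 K) 4 \<cong> Z2_power N \<and>
    minimally_generated_by (Lie_component (RC 4 K) 4)
      (map (\<lambda>(a, b, c, d). \<mu>_bracket4 4 K ([i, j, k, l] ! a) ([i, j, k, l] ! b)
        ([i, j, k, l] ! c) ([i, j, k, l] ! d)) qs)"
unfolding N[symmetric]
proof (rule RC_Lie_component_4[OF letters_bij[OF assms(1,2)] _ basis])
  let ?\<sigma> = "(!) [i, j, k, l]"
  have less: "{?\<sigma> a, ?\<sigma> b} \<in> K \<longleftrightarrow> comm_letters es a b" if "a < b" "b < 4" for a b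
  proof -
    have "(a, b) \<in> {(0, 1), (0, 2), (0, 3), (1, 2), (1, 3), (2, 3)}" using that by auto
    then show ?thesis using edges by (elim insertE emptyE) simp_all
  qed
  show "{?\<sigma> a, ?\<sigma> b} \<in> K \<longleftrightarrow> comm_letters es a b" if "a < 4" "b < 4" "a \<noteq> b" for a b
    using that less[of a b] less[of b a] insert_commute[of "?\<sigma> a" "?\<sigma> b" "{}"] comm_letters_sym[of es a b]
    by (cases a b rule: linorder_cases) simp_all
qed

text \<open>Splits the conjunction of cases into its ten implications without breaking up the
  conjunctions inside their conclusions.\<close>

lemma conj_impI: "(P \<Longrightarrow> Q) \<Longrightarrow> R \<Longrightarrow> (P \<longrightarrow> Q) \<and> R"
  by blast

theorem proposition4p1:
  fixes K :: "nat set set" and i j k l :: nat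
  assumes "simplicial_complex 4 K"
    and "distinct [i, j, k, l]" and "{i, j, k, l} = {1..4}"
  shows "(edges K = {e. e \<subseteq> {1..4} \<and> card e = 2} \<longrightarrow>
       trivial_group (Lie_component (RC 4 K) 4) \<and>
       minimally_generated_by (Lie_component (RC 4 K) 4)
          []) \<and>
    (i < j \<and> missing_edges 4 K = {{i, j}} \<longrightarrow>
       Lie_component (RC 4 K) 4 \<cong> Z2 \<and>
       minimally_generated_by (Lie_component (RC 4 K) 4)
          [\<mu>_bracket4 4 K j i i i]) \<and>
    (k < i \<and> l < j \<and> missing_edges 4 K = {{i, k}, {j, l}} \<longrightarrow>
       Lie_component (RC 4 K) 4 \<cong> Z2 \<times>\<times> Z2 \<and>
       minimally_generated_by (Lie_component (RC 4 K) 4)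
          [\<mu>_bracket4 4 K i k k k, \<mu>_bracket4 4 K j l l l]) \<and>
    (i < k \<and> k < l \<and> missing_edges 4 K = {{i, k}, {k, l}} \<longrightarrow>
       Lie_component (RC 4 K) 4 \<cong> Z2_power 4 \<and>
       minimally_generated_by (Lie_component (RC 4 K) 4)
          [\<mu>_bracket4 4 K k i i i, \<mu>_bracket4 4 K l k k k, \<mu>_bracket4 4 K k l k i, \<mu>_bracket4 4 K k l i k]) \<and>
    (i < j \<and> j < k \<and> edges K = {{l, j}, {l, k}, {l, i}} \<longrightarrow>
       Lie_component (RC 4 K) 4 \<cong> Z2_power 8 \<and>
       minimally_generated_by (Lie_component (RC 4 K) 4)
          [\<mu>_bracket4 4 K j i i i, \<mu>_bracket4 4 K k i i i, \<mu>_bracket4 4 K k j j i, \<mu>_bracket4 4 K k i j i,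
           \<mu>_bracket4 4 K k i i j, \<mu>_bracket4 4 K k j j j, \<mu>_bracket4 4 K k j i j, \<mu>_bracket4 4 K k i j k]) \<and>
    (j < k \<and> k < l \<and> edges K = {{j, k}, {j, l}, {k, l}} \<longrightarrow>
       Lie_component (RC 4 K) 4 \<cong> Z2_power 10 \<and>
       minimally_generated_by (Lie_component (RC 4 K) 4)
          [\<mu>_bracket4 4 K i k i j, \<mu>_bracket4 4 K i k j i, \<mu>_bracket4 4 K i j j j, \<mu>_bracket4 4 K i l i j,
           \<mu>_bracket4 4 K i l j i, \<mu>_bracket4 4 K i k k k, \<mu>_bracket4 4 K l i i i, \<mu>_bracket4 4 K i l i k,
           \<mu>_bracket4 4 K i l k i, \<mu>_bracket4 4 K i l j k]) \<and>
    (edges K = {{i, j}, {j, k}, {k, l}} \<longrightarrow>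
       Lie_component (RC 4 K) 4 \<cong> Z2_power 8 \<and>
       minimally_generated_by (Lie_component (RC 4 K) 4)
          [\<mu>_bracket4 4 K k i k k, \<mu>_bracket4 4 K i l i k, \<mu>_bracket4 4 K i l k i, \<mu>_bracket4 4 K i l i i,
           \<mu>_bracket4 4 K l j l l, \<mu>_bracket4 4 K l j l i, \<mu>_bracket4 4 K l j i l, \<mu>_bracket4 4 K l j i k]) \<and>
    (edges K = {{i, j}, {i, l}} \<longrightarrow>
       Lie_component (RC 4 K) 4 \<cong> Z2_power 15 \<and>
       minimally_generated_by (Lie_component (RC 4 K) 4)
          [\<mu>_bracket4 4 K l k k j, \<mu>_bracket4 4 K l j k j, \<mu>_bracket4 4 K l j j k, \<mu>_bracket4 4 K l k j k,
           \<mu>_bracket4 4 K l j k l, \<mu>_bracket4 4 K i k k j, \<mu>_bracket4 4 K i k j k, \<mu>_bracket4 4 K k j j j,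
           \<mu>_bracket4 4 K l j j j, \<mu>_bracket4 4 K l k l l, \<mu>_bracket4 4 K k i k k, \<mu>_bracket4 4 K k i k l,
           \<mu>_bracket4 4 K k i l k, \<mu>_bracket4 4 K k i l j, \<mu>_bracket4 4 K k i j l]) \<and>
    (edges K = {{i, j}, {k, l}} \<longrightarrow>
       Lie_component (RC 4 K) 4 \<cong> Z2_power 15 \<and>
       minimally_generated_by (Lie_component (RC 4 K) 4)
          [\<mu>_bracket4 4 K k j k i, \<mu>_bracket4 4 K k j i k, \<mu>_bracket4 4 K k i k k, \<mu>_bracket4 4 K i l i k,
           \<mu>_bracket4 4 K i l k i, \<mu>_bracket4 4 K i l i i, \<mu>_bracket4 4 K l j l i, \<mu>_bracket4 4 K l j i l,
           \<mu>_bracket4 4 K k j k k, \<mu>_bracket4 4 K j l j j, \<mu>_bracket4 4 K j l j k, \<mu>_bracket4 4 K j l k j,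
           \<mu>_bracket4 4 K i l k j, \<mu>_bracket4 4 K j l i k, \<mu>_bracket4 4 K j l k i]) \<and>
    (edges K = {{i, j}} \<longrightarrow>
       Lie_component (RC 4 K) 4 \<cong> Z2_power 23 \<and>
       minimally_generated_by (Lie_component (RC 4 K) 4)
          [\<mu>_bracket4 4 K i l l k, \<mu>_bracket4 4 K i k l k, \<mu>_bracket4 4 K i k k l, \<mu>_bracket4 4 K i l k l,
           \<mu>_bracket4 4 K i k l i, \<mu>_bracket4 4 K l k k k, \<mu>_bracket4 4 K j l l k, \<mu>_bracket4 4 K j k l k,
           \<mu>_bracket4 4 K j k k l, \<mu>_bracket4 4 K j l k l, \<mu>_bracket4 4 K j k l j, \<mu>_bracket4 4 K i k i i,
           \<mu>_bracket4 4 K k j k k, \<mu>_bracket4 4 K k j k i, \<mu>_bracket4 4 K k j i k, \<mu>_bracket4 4 K i l i i,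
           \<mu>_bracket4 4 K l j l l, \<mu>_bracket4 4 K l j l i, \<mu>_bracket4 4 K l j i l, \<mu>_bracket4 4 K l j i k,
           \<mu>_bracket4 4 K k j i l, \<mu>_bracket4 4 K k j l i, \<mu>_bracket4 4 K l j k i])"
proof -
  note L = RC_4_Lie_component_4[OF assms(2,3)]
  have ne: "i \<noteq> j" "i \<noteq> k" "i \<noteq> l" "j \<noteq> k" "j \<noteq> l" "k \<noteq> l"
    using assms(2) by auto
  have in4: "i \<in> {1..4}" "j \<in> {1..4}" "k \<in> {1..4}" "l \<in> {1..4}"
    using assms(3) by auto
  \<comment> \<open>Whether a pair is an edge is read off from whichever list a case provides, the
    edges present or the edges missing.\<close>
  have e: "{a, b} \<in> K \<longleftrightarrow> {a, b} \<in> edges K" if "a \<noteq> b" for a b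
    using that by (simp add: edges_def)
  have m: "{a, b} \<in> K \<longleftrightarrow> {a, b} \<notin> missing_edges 4 K" if "a \<noteq> b" "a \<in> {1..4}" "b \<in> {1..4}" for a b
    using that by (simp add: missing_edges_def)
  note e' = e[OF ne(1)] e[OF ne(2)] e[OF ne(3)] e[OF ne(4)] e[OF ne(5)] e[OF ne(6)]
  note m' = m[OF ne(1) in4(1,2)] m[OF ne(2) in4(1,3)] m[OF ne(3) in4(1,4)]
    m[OF ne(4) in4(2,3)] m[OF ne(5) in4(2,4)] m[OF ne(6) in4(3,4)]
  note S = comm_letters_def doubleton_eq_iff ne ne[symmetric]
  have iso1: "X \<cong> Z2 \<and> P" if "X \<cong> Z2_power 1 \<and> P" for X :: "nat word set set monoid" and P
    using that iso_trans[OF _ Z2_power_1_iso] by blast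
  have iso2: "X \<cong> Z2 \<times>\<times> Z2 \<and> P" if "X \<cong> Z2_power 2 \<and> P" for X :: "nat word set set monoid" and P
    using that iso_trans[OF _ Z2_power_2_iso] by blast
  show ?thesis
  proof (intro conj_impI impI, goal_cases)
    case 1
    then have "minimally_generated_by (Lie_component (RC 4 K) 4) []"
      using L[OF _ _ _ _ _ _ basis_complete, where N = 0] in4 by (simp add: e' S)
    moreover have "group (Lie_component (RC 4 K) 4)"
      by (rule group.Lie_component_group[OF RC_group])
    \<comment> \<open>The empty set generates only the unit, so generation by the empty list already
      makes the group trivial.\<close>
    ultimately show ?case
      by (simp add: trivial_group_def minimally_generated_by_def group.generate_empty)
  next
    case 2
    then show ?case using L[OF _ _ _ _ _ _ basis_diamond, where N = 1] by (intro iso1) (simp add: m' S)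
  next
    case 3
    then show ?case using L[OF _ _ _ _ _ _ basis_square, where N = 2] by (intro iso2) (simp add: m' S)
  next
    case 4
    then show ?case using L[OF _ _ _ _ _ _ basis_paw, where N = 4] by (simp add: m' S)
  next
    case 5
    then show ?case using L[OF _ _ _ _ _ _ basis_star, where N = 8] by (simp add: e' S)
  next
    case 6
    then show ?case using L[OF _ _ _ _ _ _ basis_triangle, where N = 10] by (simp add: e' S)
  next
    case 7
    then show ?case using L[OF _ _ _ _ _ _ basis_path, where N = 8] by (simp add: e' S)
  next
    case 8
    then show ?case using L[OF _ _ _ _ _ _ basis_two_adjacent_edges, where N = 15] by (simp add: e' S)
  next
    case 9
    then show ?case using L[OF _ _ _ _ _ _ basis_two_disjoint_edges, where N = 15] by (simp add: e' S)
  next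
    case 10
    then show ?case using L[OF _ _ _ _ _ _ basis_one_edge, where N = 23] by (simp add: e' S)
  qed
qed

end
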